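(* Let $t\in\mathbb{N}$ and let $G$ be a circle graph with treewidth at least $12t+2$. Then $G$ contains an induced subgraph $H$ that consists of $t$ vertex-disjoint cycles $C_1,\dots,C_t$ such that for all $1\le i<j\le t$, every vertex of $C_i$ has at least two neighbours in $C_j$. Moreover, every vertex of $G$ has at most four neighbours in any $C_i$ ($1\le i\le t$).
   Context: A chord of a circle $C$ in $\mathbb{R}^2$ is a closed line segment with distinct endpoints on $C$; two chords cross if they intersect at a point that is not an endpoint of either. A circle graph is a graph isomorphic to the graph whose vertices are the chords of a finite set $S$ of chords of a circle (no three chords of $S$ crossing at a single point), two chords being adjacent if and only if they cross. *)

theory Defs
  imports "HOL-Analysis.Analysis" "Graph_Theory.Digraph_Component" "Graph_Theory.Digraph_Isomorphism"
begin

text \<open>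
  Simple graphs are symmetric loop-free pair digraphs (\<^locale>\<open>pair_graph\<close>): an undirected edge
  \<open>uv\<close> is represented by the two arcs \<open>(u, v)\<close> and \<open>(v, u)\<close>.
\<close>

definition neighbours_in :: "'a pair_pre_digraph \<Rightarrow> 'a \<Rightarrow> 'a set \<Rightarrow> 'a set" where
  "neighbours_in G v X = {w \<in> X. (v, w) \<in> parcs G}"

definition cycle_graph :: "'a pair_pre_digraph \<Rightarrow> bool" where
  "cycle_graph C \<longleftrightarrow>
     (\<exists>vs. distinct vs \<and> length vs \<ge> 3 \<and> pverts C = set vs \<and>
        parcs C = (\<Union>i<length vs. {(vs ! i, vs ! (Suc i mod length vs)),
                                      (vs ! (Suc i mod length vs), vs ! i)}))"

text \<open>
  The library's \<^const>\<open>tree\<close> forbids directed cycles, among them \<open>u, v, u\<close> in a symmetric digraph,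
  so it is not the undirected notion needed here.
\<close>

definition undirected_tree :: "'a pair_pre_digraph \<Rightarrow> bool" where
  "undirected_tree T \<longleftrightarrow>
     pair_graph T \<and> Digraph_Component.connected (with_proj T) \<and>
     \<not> (\<exists>C. cycle_graph C \<and> subgraph (with_proj C) (with_proj T))"

text \<open>\<^const>\<open>Digraph_Component.connected\<close> includes non-emptiness, so every vertex lies in some bag.\<close>

definition tree_decomposition ::
    "'a pair_pre_digraph \<Rightarrow> 'b pair_pre_digraph \<Rightarrow> ('b \<Rightarrow> 'a set) \<Rightarrow> bool" where
  "tree_decomposition G T B \<longleftrightarrow>
     undirected_tree T \<and>
     (\<forall>x\<in>pverts T. B x \<subseteq> pverts G) \<and>
     (\<forall>v\<in>pverts G. Digraph_Component.connected (with_proj T \<restriction> {x \<in> pverts T. v \<in> B x})) \<and>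
     (\<forall>u v. (u, v) \<in> parcs G \<longrightarrow> (\<exists>x\<in>pverts T. u \<in> B x \<and> v \<in> B x))"

definition decomposition_width :: "'b pair_pre_digraph \<Rightarrow> ('b \<Rightarrow> 'a set) \<Rightarrow> nat" where
  "decomposition_width T B = Max ((\<lambda>x. card (B x)) ` pverts T) - 1"

text \<open>
  Meant for finite graphs. Decomposition trees are finite, so nodes of type \<^typ>\<open>nat\<close> suffice. The
  truncated subtraction in the width matters only for the null graph, which gets treewidth 0.
\<close>

definition treewidth :: "'a pair_pre_digraph \<Rightarrow> nat" where
  "treewidth G =
     (LEAST w. \<exists>(T :: nat pair_pre_digraph) B.
        tree_decomposition G T B \<and> decomposition_width T B = w)"

definition chord_of :: "(real ^ 2) set \<Rightarrow> (real ^ 2) set \<Rightarrow> bool" where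
  "chord_of K s \<longleftrightarrow> (\<exists>a\<in>K. \<exists>b\<in>K. a \<noteq> b \<and> s = closed_segment a b)"

definition endpoint_of :: "real ^ 2 \<Rightarrow> (real ^ 2) set \<Rightarrow> bool" where
  "endpoint_of p s \<longleftrightarrow> (\<exists>q. s = closed_segment p q)"

definition cross_at :: "real ^ 2 \<Rightarrow> (real ^ 2) set \<Rightarrow> (real ^ 2) set \<Rightarrow> bool" where
  "cross_at p s s' \<longleftrightarrow> s \<noteq> s' \<and> p \<in> s \<inter> s' \<and> \<not> endpoint_of p s \<and> \<not> endpoint_of p s'"

definition crossing_graph :: "(real ^ 2) set set \<Rightarrow> (real ^ 2) set pair_pre_digraph" where
  "crossing_graph S =
     \<lparr>pverts = S, parcs = {(s, s'). s \<in> S \<and> s' \<in> S \<and> (\<exists>p. cross_at p s s')}\<rparr>"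

definition circle_graph :: "'a pair_pre_digraph \<Rightarrow> bool" where
  "circle_graph G \<longleftrightarrow>
     (\<exists>(c :: real ^ 2) r S. r > 0 \<and> finite S \<and> (\<forall>s\<in>S. chord_of (sphere c r) s) \<and>
        \<not> (\<exists>p. \<exists>s1\<in>S. \<exists>s2\<in>S. \<exists>s3\<in>S. cross_at p s1 s2 \<and> cross_at p s1 s3 \<and> cross_at p s2 s3) \<and>
        digraph_iso (with_proj G) (with_proj (crossing_graph S)))"

end

theory Submission
  imports Defs
begin

text \<open>
  Fix a point \<open>p\<close> of the disc, and let every chord cut off the arc of the circle on the
  side that does not contain \<open>p\<close>. An inclusion-minimal family of these arcs that covers
  the circle is cyclically ordered, with exactly the consecutive arcs overlapping: its chords form
  an induced cycle, and every point of the circle lies in at most two of its arcs, so that every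
  chord crosses at most four of its chords. If every point of the circle is separated from
  \<open>p\<close> by at least \<open>2 t\<close> chords, then \<open>t\<close> disjoint minimal
  covers can be removed one after the other. Taking each of them among the inclusion-maximal arcs
  that remain forces its chords to cross at least two chords of every later cover.

  Otherwise the disc is covered by the closed sets \<open>U\<^sub>z\<close> of the points separated
  from \<open>z\<close> by at most \<open>2 t - 1\<close> chords, where \<open>z\<close> ranges over
  the gaps between consecutive endpoints. They are star-shaped, so those of the gaps strictly
  between two gaps \<open>x\<close>, \<open>y\<close>, and those of the other gaps, form two closed
  connected sets, whose intersection is connected because the disc is unicoherent. From this, every
  scanline \<open>x y\<close> crossed by at most \<open>8 t\<close> chords is completed by some gap
  \<open>z\<close> to a triangle all of whose sides are crossed by at most \<open>8 t\<close>
  chords. The resulting triangulation is a tree decomposition with bags of size at most \<open>12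
  t\<close>, the bag of a triangle consisting of the chords that meet it.
\<close>

section \<open>Chord diagrams and minimal covers by arcs\<close>

locale chord_diagram =
  fixes V :: "'a set" and l r :: "'a \<Rightarrow> nat" and N :: nat
  assumes finite_V: "finite V"
    and l_less_r: "v \<in> V \<Longrightarrow> l v < r v"
    and r_less_N: "v \<in> V \<Longrightarrow> r v < N"
    and inj_l: "inj_on l V"
    and inj_r: "inj_on r V"
    and l_neq_r: "\<lbrakk>u \<in> V; v \<in> V\<rbrakk> \<Longrightarrow> l u \<noteq> r v"
begin

definition crosses :: "'a \<Rightarrow> 'a \<Rightarrow> bool" where
  "crosses u v \<longleftrightarrow> l u < l v \<and> l v < r u \<and> r u < r v \<or> l v < l u \<and> l u < r v \<and> r v < r u"

text \<open>Gap \<open>g\<close> is the place just before position \<open>g\<close>; on the circle, gaps \<open>0\<close> and \<open>N\<close> coincide.\<close>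

definition between :: "'a \<Rightarrow> nat \<Rightarrow> bool" where
  "between v g \<longleftrightarrow> l v < g \<and> g \<le> r v"

text \<open>These are the chords met by a scanline drawn from gap \<open>x\<close> to gap
  \<open>y\<close>.\<close>

definition separating :: "nat \<Rightarrow> nat \<Rightarrow> 'a set" where
  "separating x y = {v \<in> V. between v x \<noteq> between v y}"

lemma l_eq_iff: "\<lbrakk>u \<in> V; v \<in> V\<rbrakk> \<Longrightarrow> l u = l v \<longleftrightarrow> u = v"
  using inj_l by (auto dest: inj_onD)

lemma r_eq_iff: "\<lbrakk>u \<in> V; v \<in> V\<rbrakk> \<Longrightarrow> r u = r v \<longleftrightarrow> u = v"
  using inj_r by (auto dest: inj_onD)

lemma l_less_N: "v \<in> V \<Longrightarrow> l v < N"
  using l_less_r r_less_N by fastforce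

lemma crosses_sym: "crosses u v \<longleftrightarrow> crosses v u"
  by (auto simp: crosses_def)

lemma crosses_irrefl: "\<not> crosses v v"
  by (auto simp: crosses_def)

lemma not_between_0: "\<not> between v 0"
  by (auto simp: between_def)

lemma not_between_N: "v \<in> V \<Longrightarrow> \<not> between v N"
  using r_less_N by (fastforce simp: between_def)

end

text \<open>An orientation selects for every chord one of its two sides. It plays the role of a point of
  the disc: the selected sides are those that do not contain the point.\<close>

locale oriented_diagram = chord_diagram +
  fixes inner :: "'a \<Rightarrow> bool"
begin

definition arc :: "'a \<Rightarrow> nat \<Rightarrow> bool" where
  "arc v g \<longleftrightarrow> (between v g \<longleftrightarrow> inner v)"

text \<open>If the outer side is selected, the arc runs from \<open>r v\<close> through the cut to
  \<open>l v\<close>; adding \<open>N\<close> to its end keeps it an interval of integers.\<close>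

definition start :: "'a \<Rightarrow> int" where
  "start v = (if inner v then int (l v) else int (r v))"

definition stop :: "'a \<Rightarrow> int" where
  "stop v = (if inner v then int (r v) else int (l v) + int N)"

definition lifted_arc :: "'a \<Rightarrow> int \<Rightarrow> bool" where
  "lifted_arc v g \<longleftrightarrow> (\<exists>k. start v < g + k * int N \<and> g + k * int N \<le> stop v)"

lemma lifted_arc_periodic: "lifted_arc v (g + k * int N) \<longleftrightarrow> lifted_arc v g"
proof -
  have "lifted_arc v (g + k * int N)" if arc: "lifted_arc v g" for g k
  proof -
    obtain j where "start v < g + j * int N \<and> g + j * int N \<le> stop v"
      using arc unfolding lifted_arc_def by blast
    then show ?thesis
      unfolding lifted_arc_def by (intro exI[of _ "j - k"]) (simp add: algebra_simps)
  qed
  from this[of g k] this[of "g + k * int N" "- k"] show ?thesis by (auto simp: algebra_simps)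
qed

lemma lifted_arc_iff:
  assumes "v \<in> V" "g \<le> N"
  shows "lifted_arc v (int g) \<longleftrightarrow> arc v g"
proof
  assume "lifted_arc v (int g)"
  then obtain k where k: "start v < int g + k * int N" "int g + k * int N \<le> stop v"
    by (auto simp: lifted_arc_def)
  have b: "l v < r v" "r v < N" "l v < N" using assms l_less_r r_less_N l_less_N by auto
  \<comment> \<open>Since \<open>0 \<le> start v\<close> and \<open>stop v < 2 * int N\<close>, only
    the translates by \<open>0\<close> and by one period can carry the gap into the arc.\<close>
  consider "k \<le> -1" | "k = 0" | "k = 1" | "k \<ge> 2" by linarith
  then show "arc v g"
  proof cases
    case 1
    then have "k * int N \<le> (-1) * int N" by (intro mult_right_mono) auto
    moreover have "0 \<le> start v" by (simp add: start_def)
    ultimately have False using k assms by linarith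
    then show ?thesis ..
  next
    case 4
    then have "2 * int N \<le> k * int N" by (intro mult_right_mono) auto
    moreover have "stop v < 2 * int N" using b by (auto simp: stop_def)
    ultimately have False using k by linarith
    then show ?thesis ..
  qed (use k b assms in \<open>auto simp: start_def stop_def arc_def between_def split: if_splits\<close>)
next
  assume "arc v g"
  have b: "l v < r v" "r v < N" "l v < N" using assms l_less_r r_less_N l_less_N by auto
  show "lifted_arc v (int g)"
  proof (cases "inner v \<or> r v < g")
    case True
    then show ?thesis using \<open>arc v g\<close> b assms unfolding lifted_arc_def
      by (intro exI[of _ 0]) (auto simp: arc_def between_def start_def stop_def)
  next
    case False
    then show ?thesis using \<open>arc v g\<close> b assms unfolding lifted_arc_def
      by (intro exI[of _ 1]) (auto simp: arc_def between_def start_def stop_def)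
  qed
qed

text \<open>Chords cross when the ends of one lie on different sides of the other, whichever side is
  selected. The gap \<open>l v\<close> can stand for the position \<open>l v\<close> because
  \<open>u\<close> has no end there.\<close>

lemma crosses_iff_arc:
  assumes "u \<in> V" "v \<in> V" "u \<noteq> v"
  shows "crosses u v \<longleftrightarrow> arc u (l v) \<noteq> arc u (r v)"
  using assms l_less_r[of u] l_less_r[of v] l_eq_iff[of u v] r_eq_iff[of u v] l_neq_r[of u v] l_neq_r[of v u]
  by (auto simp: crosses_def arc_def between_def)

lemma crosses_iff_lifted_arc:
  assumes "u \<in> V" "v \<in> V" "u \<noteq> v"
  shows "crosses u v \<longleftrightarrow> lifted_arc u (start v) \<noteq> lifted_arc u (stop v)"
proof -
  have "lifted_arc u (int (l v) + int N) = lifted_arc u (int (l v))"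
    using lifted_arc_periodic[of u "int (l v)" 1] by simp
  moreover have "lifted_arc u (int (l v)) = arc u (l v)" "lifted_arc u (int (r v)) = arc u (r v)"
    using lifted_arc_iff assms l_less_N[of v] r_less_N[of v] by auto
  ultimately show ?thesis
    using crosses_iff_arc[OF assms] by (auto simp: start_def stop_def)
qed

lemma start_bounds:
  assumes "v \<in> V" shows "0 \<le> start v" "start v < int N" "start v < stop v" "stop v < start v + int N"
  using assms l_less_r[of v] r_less_N[of v] by (auto simp: start_def stop_def)

lemma start_eq_iff: "\<lbrakk>u \<in> V; v \<in> V\<rbrakk> \<Longrightarrow> start u = start v \<longleftrightarrow> u = v"
  using l_eq_iff[of u v] r_eq_iff[of u v] l_neq_r[of u v] l_neq_r[of v u] by (auto simp: start_def)

text \<open>Modulo \<open>N\<close> both sides reduce to endpoint positions. These coincide only for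
  the same end of the same chord, which cannot be both the start and the stop of its arc.\<close>

lemma start_neq_stop:
  assumes "u \<in> V" "v \<in> V" shows "start u \<noteq> stop v + k * int N"
proof
  assume eq: "start u = stop v + k * int N"
  have "stop v mod int N = int (if inner v then r v else l v)"
    using assms r_less_N[of v] l_less_N[of v] by (auto simp: stop_def)
  moreover have "start u mod int N = int (if inner u then l u else r u)"
    using assms r_less_N[of u] l_less_N[of u] by (auto simp: start_def)
  ultimately have "(if inner v then r v else l v) = (if inner u then l u else r u)"
    using eq by simp
  then show False
    using assms l_neq_r[of u v] l_neq_r[of v u] l_eq_iff[of u v] r_eq_iff[of u v]
    by (auto split: if_splits)
qed

end

section \<open>Minimal covers of the circle as cyclic sequences of arcs\<close>

locale minimal_cover = oriented_diagram +
  fixes M :: "'a set"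
  assumes M_subset: "M \<subseteq> V"
    and cover: "g \<le> N \<Longrightarrow> \<exists>v\<in>M. arc v g"
    and private_gap: "v \<in> M \<Longrightarrow> \<exists>g\<le>N. \<forall>u\<in>M. arc u g \<longrightarrow> u = v"
    and three: "card M \<ge> 3"
begin

definition ordering :: "'a list" where
  "ordering = sort_key start (SOME xs. set xs = M \<and> distinct xs)"

lemma finite_M: "finite M"
  using M_subset finite_V finite_subset by blast

lemma ordering: "set ordering = M" "distinct ordering" "sorted (map start ordering)"
proof -
  have "\<exists>xs. set xs = M \<and> distinct xs" using finite_M finite_distinct_list by blast
  then have "set (SOME xs. set xs = M \<and> distinct xs) = M \<and> distinct (SOME xs. set xs = M \<and> distinct xs)"
    by (rule someI_ex)
  then show "set ordering = M" "distinct ordering" "sorted (map start ordering)"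
    by (auto simp: ordering_def)
qed

definition m :: int where "m = int (length ordering)"

lemma m_ge_3: "m \<ge> 3"
  using three distinct_card[OF ordering(2)] by (simp add: m_def ordering(1))

text \<open>The arcs of the cover, unrolled to the line and indexed by all integers in the order of their
  starting points.\<close>

definition el :: "int \<Rightarrow> 'a" where "el i = ordering ! nat (i mod m)"
definition lo :: "int \<Rightarrow> int" where "lo i = start (el i) + int N * (i div m)"
definition hi :: "int \<Rightarrow> int" where "hi i = stop (el i) + int N * (i div m)"

lemma el_in_M: "el i \<in> M"
proof -
  have "nat (i mod m) < length ordering"
    using m_ge_3 pos_mod_bound[of m i] pos_mod_sign[of m i] unfolding m_def by linarith
  then show ?thesis unfolding el_def using ordering(1) nth_mem by blast
qed

lemma el_in_V: "el i \<in> V"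
  using el_in_M M_subset by blast

lemma el_eq_iff: "el i = el j \<longleftrightarrow> i mod m = j mod m"
proof -
  have "nat (i mod m) < length ordering" for i
    using m_ge_3 pos_mod_bound[of m i] pos_mod_sign[of m i] unfolding m_def by linarith
  then have "el i = el j \<longleftrightarrow> nat (i mod m) = nat (j mod m)"
    unfolding el_def using ordering(2) by (simp add: nth_eq_iff_index_eq)
  moreover have "0 \<le> i mod m" "0 \<le> j mod m" using m_ge_3 by simp_all
  ultimately show ?thesis by (metis nat_eq_iff2)
qed

lemma el_surj: "v \<in> M \<Longrightarrow> \<exists>i. el i = v"
proof -
  assume "v \<in> M"
  then obtain k where "k < length ordering" "ordering ! k = v"
    using ordering(1) by (metis in_set_conv_nth)
  then have "el (int k) = v" by (simp add: el_def m_def)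
  then show ?thesis ..
qed

lemma lo_step: "lo i < lo (i + 1)"
proof (cases "i mod m + 1 < m")
  case True
  have "i + 1 = m * (i div m) + (i mod m + 1)" "0 \<le> i mod m + 1"
    using m_ge_3 by (simp_all add: add_nonneg_nonneg)
  then have s: "(i + 1) mod m = i mod m + 1" "(i + 1) div m = i div m"
    using True int_mod_pos_eq int_div_pos_eq by blast+
  let ?k = "nat (i mod m)"
  have k: "Suc ?k < length ordering" "nat (i mod m + 1) = Suc ?k"
    using True m_ge_3 pos_mod_sign[of m i] unfolding m_def by linarith+
  have "start (ordering ! ?k) \<le> start (ordering ! Suc ?k)"
    using ordering(3) k by (auto simp: sorted_iff_nth_Suc)
  moreover have "ordering ! ?k \<noteq> ordering ! Suc ?k"
    using ordering(2) k by (simp add: nth_eq_iff_index_eq)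
  moreover have "ordering ! ?k \<in> V" "ordering ! Suc ?k \<in> V"
    using k ordering(1) M_subset by (auto intro: nth_mem)
  ultimately have "start (ordering ! ?k) < start (ordering ! Suc ?k)"
    using start_eq_iff by force
  then show ?thesis by (simp add: lo_def el_def s k(2))
next
  case False
  then have e: "i mod m = m - 1" using m_ge_3 pos_mod_bound[of m i] by linarith
  then have "i + 1 = m * (i div m + 1) + 0"
    using mult_div_mod_eq[of m i] unfolding distrib_left by linarith
  then have "(i + 1) div m = i div m + 1" using m_ge_3 by (intro int_div_pos_eq) auto
  then show ?thesis
    using start_bounds[OF el_in_V, of i] start_bounds[OF el_in_V, of "i + 1"]
    by (simp add: lo_def algebra_simps)
qed

lemma lo_mono: "i < j \<Longrightarrow> lo i < lo j"
proof (induction j rule: int_gr_induct)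
  case base
  then show ?case by (rule lo_step)
next
  case (step j)
  then show ?case using lo_step[of j] by simp
qed

lemma lo_less_iff: "lo i < lo j \<longleftrightarrow> i < j"
  using lo_mono[of i j] lo_mono[of j i] by (cases i j rule: linorder_cases) auto

lemma shift:
  "el (i + k * m) = el i" "lo (i + k * m) = lo i + k * int N" "hi (i + k * m) = hi i + k * int N"
  using m_ge_3 by (auto simp: el_def lo_def hi_def algebra_simps)

text \<open>Changing the index by a multiple of \<open>m\<close> translates the interval by as many
  periods, so the lift of one arc is the union of the intervals over a residue class of
  indices.\<close>

lemma lifted_arc_el:
  "lifted_arc (el i) g \<longleftrightarrow> (\<exists>j. j mod m = i mod m \<and> lo j < g \<and> g \<le> hi j)"
proof
  assume "lifted_arc (el i) g"
  then obtain k where k: "start (el i) < g + k * int N" "g + k * int N \<le> stop (el i)"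
    by (auto simp: lifted_arc_def)
  let ?j = "i + (- k - i div m) * m"
  have "?j mod m = i mod m" by simp
  moreover have "lo ?j = start (el i) - k * int N" "hi ?j = stop (el i) - k * int N"
    unfolding shift by (simp_all add: lo_def hi_def algebra_simps)
  ultimately show "\<exists>j. j mod m = i mod m \<and> lo j < g \<and> g \<le> hi j"
    using k by (intro exI[of _ ?j]) auto
next
  assume "\<exists>j. j mod m = i mod m \<and> lo j < g \<and> g \<le> hi j"
  then obtain j where j: "j mod m = i mod m" "lo j < g" "g \<le> hi j" by blast
  then have "el j = el i" by (simp add: el_eq_iff)
  then show "lifted_arc (el i) g"
    using j unfolding lifted_arc_def lo_def hi_def
    by (intro exI[of _ "- (j div m)"]) (auto simp: algebra_simps)
qed

lemma N_pos: "N > 0"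
  using r_less_N[OF el_in_V[of 0]] by simp

lemma covered: "\<exists>i. lo i < g \<and> g \<le> hi i"
proof -
  have "nat (g mod int N) \<le> N" using N_pos
    by (metis nat_int nat_le_eq_zle nat_mono of_nat_0_le_iff of_nat_0_less_iff order_less_imp_le pos_mod_bound)
  then obtain v where v: "v \<in> M" "arc v (nat (g mod int N))" using cover by blast
  then have "lifted_arc v (int (nat (g mod int N)))"
    using \<open>nat (g mod int N) \<le> N\<close> lifted_arc_iff M_subset by blast
  moreover have "int (nat (g mod int N)) = g + (- (g div int N)) * int N"
    using N_pos minus_div_mult_eq_mod[of g "int N"] by simp
  ultimately have "lifted_arc v g" using lifted_arc_periodic by metis
  moreover obtain i where "el i = v" using v el_surj by blast
  ultimately show ?thesis using lifted_arc_el by blast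
qed

text \<open>This is the private gap of \<open>el i\<close>, moved by whole periods into the interval
  with index \<open>i\<close> itself. Privacy is a matter of arcs, hence the congruence of
  indices.\<close>

lemma private_point:
  "\<exists>g. lo i < g \<and> g \<le> hi i \<and> (\<forall>j. lo j < g \<and> g \<le> hi j \<longrightarrow> j mod m = i mod m)"
proof -
  obtain g where g: "g \<le> N" "\<forall>u\<in>M. arc u g \<longrightarrow> u = el i"
    using private_gap el_in_M by blast
  then have "arc (el i) g" using cover by blast
  then have "lifted_arc (el i) (int g)" using lifted_arc_iff g el_in_V by blast
  then obtain j where j: "j mod m = i mod m" "lo j < int g" "int g \<le> hi j"
    using lifted_arc_el by blast
  define k where "k = i div m - j div m"
  have i: "i = j + k * m" 
    using j(1) div_mult_mod_eq[of i m] div_mult_mod_eq[of j m]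
    unfolding k_def left_diff_distrib by linarith
  have uniq: "j' mod m = i mod m" if "lo j' < int g + k * int N" "int g + k * int N \<le> hi j'" for j'
  proof -
    have "lo (j' + (- k) * m) < int g" "int g \<le> hi (j' + (- k) * m)"
      using that unfolding shift by auto
    then have "lifted_arc (el (j' + (- k) * m)) (int g)" using lifted_arc_el by blast
    then have "arc (el j') g" using lifted_arc_iff g el_in_V shift(1) by metis
    then have "el j' = el i" using g el_in_M by blast
    then show ?thesis by (simp add: el_eq_iff)
  qed
  show ?thesis
    by (rule exI[of _ "int g + k * int N"]) (use j uniq in \<open>auto simp: i shift\<close>)
qed

text \<open>Otherwise the interval with the larger index would be contained in the other one and
  have no private point. For congruent indices, which privacy cannot tell apart, one interval is a
  translate of the other.\<close>

lemma hi_mono: "i < j \<Longrightarrow> hi i < hi j"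
proof (cases "i mod m = j mod m")
  case True
  assume "i < j"
  define k where "k = j div m - i div m"
  have j: "j = i + k * m" 
    using True div_mult_mod_eq[of i m] div_mult_mod_eq[of j m]
    unfolding k_def left_diff_distrib by linarith
  then have "k > 0" using \<open>i < j\<close> m_ge_3 by (simp add: zero_less_mult_iff)
  then show ?thesis unfolding j shift using N_pos by simp
next
  case False
  assume "i < j"
  obtain g where "lo j < g" "g \<le> hi j" "\<not> (lo i < g \<and> g \<le> hi i)"
    using private_point[of j] False by metis
  then show ?thesis using lo_mono[OF \<open>i < j\<close>] by linarith
qed

lemma hi_le_iff: "hi i \<le> hi j \<longleftrightarrow> i \<le> j"
  using hi_mono[of i j] hi_mono[of j i] by (cases i j rule: linorder_cases) auto

text \<open>The point \<open>lo (i + 1)\<close> is covered by an interval that starts before it,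
  hence by one of index at most \<open>i\<close>, which ends no later than the interval of index
  \<open>i\<close>.\<close>

lemma overlap: "lo (i + 1) < hi i"
proof -
  obtain j where j: "lo j < lo (i + 1)" "lo (i + 1) \<le> hi j" using covered by blast
  then have "j \<le> i" by (simp add: lo_less_iff)
  then have "hi j \<le> hi i" by (simp add: hi_le_iff)
  then have "lo (i + 1) \<le> hi i" using j by linarith
  moreover have "lo (i + 1) \<noteq> hi i"
    using start_neq_stop[OF el_in_V el_in_V, of "i + 1" i "i div m - (i + 1) div m"]
    by (auto simp: lo_def hi_def algebra_simps)
  ultimately show ?thesis by simp
qed

lemma mod_plus_neq: "0 < k \<Longrightarrow> k < m \<Longrightarrow> (i + k) mod m \<noteq> i mod m"
  by (metis add_diff_cancel_left' mod_eq_dvd_iff zdvd_not_zless)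

text \<open>A private point of the interval \<open>i + 1\<close> lies after the end of the interval
  \<open>i\<close> and not after the start of the interval \<open>i + 2\<close>.\<close>

lemma disjoint: "hi i < lo (i + 2)"
proof -
  obtain g where g: "lo (i + 1) < g" "g \<le> hi (i + 1)"
      "\<forall>j. lo j < g \<and> g \<le> hi j \<longrightarrow> j mod m = (i + 1) mod m"
    using private_point by blast
  have "\<not> (lo i < g \<and> g \<le> hi i)"
    using g(3) mod_plus_neq[of 1 i] m_ge_3 by force
  moreover have "\<not> (lo (i + 2) < g \<and> g \<le> hi (i + 2))"
    using g(3) mod_plus_neq[of 1 "i + 1"] m_ge_3 by (force simp: algebra_simps)
  moreover have "lo i < lo (i + 1)" "hi (i + 1) < hi (i + 2)"
    using lo_mono hi_mono by auto
  ultimately show ?thesis using g by linarith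
qed

text \<open>By \<open>overlap\<close> and \<open>disjoint\<close>, the arc of \<open>el i\<close>
  contains the start of \<open>el j\<close> exactly if \<open>j\<close> follows \<open>i\<close>
  cyclically, and its stop exactly if \<open>i\<close> follows \<open>j\<close>. Crossing means that
  one of the two happens but not the other.\<close>

lemma crosses_el_iff:
  assumes "el i \<noteq> el j"
  shows "crosses (el i) (el j) \<longleftrightarrow> j mod m = (i + 1) mod m \<or> i mod m = (j + 1) mod m"
proof -
  have "lifted_arc (el i) (lo j) \<longleftrightarrow> j mod m = (i + 1) mod m"
  proof
    assume "lifted_arc (el i) (lo j)"
    then obtain i' where i': "i' mod m = i mod m" "lo i' < lo j" "lo j \<le> hi i'"
      using lifted_arc_el by blast
    then have "i' < j" "lo j < lo (i' + 2)" using disjoint[of i'] lo_less_iff[of i' j] by linarith+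
    then have "j = i' + 1" by (simp add: lo_less_iff)
    then show "j mod m = (i + 1) mod m" using i'(1) by (metis mod_add_left_eq)
  next
    assume "j mod m = (i + 1) mod m"
    then have "(j - 1) mod m = i mod m" by (metis add_diff_cancel_right' mod_diff_left_eq)
    moreover have "lo (j - 1) < lo j" "lo j \<le> hi (j - 1)" using lo_mono overlap[of "j - 1"] by auto
    ultimately show "lifted_arc (el i) (lo j)" using lifted_arc_el by blast
  qed
  moreover have "lifted_arc (el i) (hi j) \<longleftrightarrow> i mod m = (j + 1) mod m"
  proof
    assume "lifted_arc (el i) (hi j)"
    then obtain i' where i': "i' mod m = i mod m" "lo i' < hi j" "hi j \<le> hi i'"
      using lifted_arc_el by blast
    then have "j \<le> i'" "lo i' < lo (j + 2)" using disjoint[of j] by (auto simp: hi_le_iff)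
    moreover have "j \<noteq> i'" using i' assms by (auto simp: el_eq_iff)
    ultimately have "i' = j + 1" by (simp add: lo_less_iff)
    then show "i mod m = (j + 1) mod m" using i'(1) by simp
  next
    assume "i mod m = (j + 1) mod m"
    moreover have "hi j \<le> hi (j + 1)" "lo (j + 1) < hi j" using hi_mono[of j "j + 1"] overlap[of j] by auto
    ultimately show "lifted_arc (el i) (hi j)" using lifted_arc_el by metis
  qed
  moreover have "lifted_arc (el i) (lo j) = lifted_arc (el i) (start (el j))"
    "lifted_arc (el i) (hi j) = lifted_arc (el i) (stop (el j))"
    using lifted_arc_periodic[of "el i" _ "j div m"] by (auto simp: lo_def hi_def mult.commute)
  \<comment> \<open>Both at once would make \<open>m\<close> divide \<open>2\<close>.\<close>
  moreover have "\<not> (j mod m = (i + 1) mod m \<and> i mod m = (j + 1) mod m)"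
  proof
    assume "j mod m = (i + 1) mod m \<and> i mod m = (j + 1) mod m"
    then have "(i + 2) mod m = i mod m" by (metis add.assoc mod_add_left_eq one_add_one)
    then show False using mod_plus_neq[of 2 i] m_ge_3 by simp
  qed
  ultimately show ?thesis
    using crosses_iff_lifted_arc[OF el_in_V el_in_V assms] by blast
qed

text \<open>Intervals whose indices differ by two or more are disjoint, and three distinct integers
  cannot have pairwise distance one.\<close>

lemma at_most_two_arcs:
  assumes "g \<le> N" shows "card {v \<in> M. arc v g} \<le> 2"
proof (rule ccontr)
  assume "\<not> ?thesis"
  then have "3 \<le> card {v \<in> M. arc v g}" by simp
  then obtain W where W: "W \<subseteq> {v \<in> M. arc v g}" "card W = 3"
    by (meson obtain_subset_with_card_n)
  then obtain u v w where uvw: "W = {u, v, w}" "u \<noteq> v" "v \<noteq> w" "u \<noteq> w"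
    by (auto simp: card_3_iff)
  have lift: "\<exists>i. el i = v \<and> lo i < int g \<and> int g \<le> hi i" if "v \<in> W" for v
  proof -
    have v: "v \<in> M" "arc v g" using that W by auto
    then have "lifted_arc v (int g)" using lifted_arc_iff assms M_subset by blast
    moreover obtain i where "el i = v" using v el_surj by blast
    ultimately show ?thesis using lifted_arc_el el_eq_iff by metis
  qed
  obtain i j k where ijk: "el i = u" "lo i < int g" "int g \<le> hi i"
      "el j = v" "lo j < int g" "int g \<le> hi j" "el k = w" "lo k < int g" "int g \<le> hi k"
    using lift uvw by (metis insertCI)
  have close: "b < a + 2" if "int g \<le> hi a" "lo b < int g" for a b
    using that disjoint[of a] lo_less_iff[of b "a + 2"] by linarith
  have "i \<noteq> j" "j \<noteq> k" "i \<noteq> k" using ijk uvw by auto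
  moreover have "i < j + 2" "j < i + 2" "i < k + 2" "k < i + 2" "j < k + 2" "k < j + 2"
    using close ijk by blast+
  ultimately show False by linarith
qed

lemma cycle_ordering:
  shows "length ordering \<ge> 3"
    and "\<lbrakk>u \<in> M; v \<in> M\<rbrakk> \<Longrightarrow> crosses u v \<longleftrightarrow>
      (\<exists>i<length ordering. (u, v) = (ordering ! i, ordering ! (Suc i mod length ordering)) \<or>
         (v, u) = (ordering ! i, ordering ! (Suc i mod length ordering)))"
proof -
  show len: "length ordering \<ge> 3" using m_ge_3 by (simp add: m_def)
  assume "u \<in> M" "v \<in> M"
  then obtain a b where a: "a < length ordering" "u = ordering ! a"
    and b: "b < length ordering" "v = ordering ! b"
    using ordering(1) by (metis in_set_conv_nth)
  have el: "el (int i) = ordering ! i" if "i < length ordering" for i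
    using that by (simp add: el_def m_def)
  have md: "int j mod m = (int i + 1) mod m \<longleftrightarrow> j = Suc i mod length ordering"
    if "j < length ordering" for i j
  proof -
    have "(int i + 1) mod m = int (Suc i mod length ordering)"
      by (simp add: m_def zmod_int add.commute)
    moreover have "int j mod m = int j" using that by (simp add: m_def)
    ultimately show ?thesis by simp
  qed
  have next_in: "Suc i mod length ordering < length ordering" for i
    using len by (intro mod_less_divisor) auto
  show "crosses u v \<longleftrightarrow>
      (\<exists>i<length ordering. (u, v) = (ordering ! i, ordering ! (Suc i mod length ordering)) \<or>
         (v, u) = (ordering ! i, ordering ! (Suc i mod length ordering)))" (is "_ \<longleftrightarrow> ?R")
  proof (cases "u = v")
    case True
    have "i \<noteq> Suc i mod length ordering" if "i < length ordering" for i
      using that len by (cases "Suc i = length ordering") auto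
    then have "\<not> ?R"
      using True ordering(2) next_in by (auto simp: nth_eq_iff_index_eq)
    then show ?thesis using True crosses_irrefl by blast
  next
    case False
    have "crosses u v \<longleftrightarrow> b = Suc a mod length ordering \<or> a = Suc b mod length ordering"
      using crosses_el_iff[of "int a" "int b"] False a b md el by auto
    also have "\<dots> \<longleftrightarrow> ?R"
      using a b ordering(2) next_in by (auto simp: nth_eq_iff_index_eq)
    finally show ?thesis .
  qed
qed

text \<open>The arc of a chord that crosses \<open>v\<close> contains one end of \<open>v\<close>,
  and each end lies in at most two arcs of the cover.\<close>

lemma few_crossings:
  assumes "v \<in> V" shows "card {u \<in> M. crosses v u} \<le> 4"
proof -
  have "{u \<in> M. crosses v u} \<subseteq> {u \<in> M. arc u (l v)} \<union> {u \<in> M. arc u (r v)}"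
  proof
    fix u assume "u \<in> {u \<in> M. crosses v u}"
    then have u: "u \<in> M" "u \<in> V" "crosses u v" "u \<noteq> v"
      using M_subset crosses_sym crosses_irrefl by auto
    then show "u \<in> {u \<in> M. arc u (l v)} \<union> {u \<in> M. arc u (r v)}"
      using crosses_iff_arc assms by auto
  qed
  then have "card {u \<in> M. crosses v u} \<le> card ({u \<in> M. arc u (l v)} \<union> {u \<in> M. arc u (r v)})"
    using finite_M by (intro card_mono) auto
  also have "\<dots> \<le> 2 + 2"
    using at_most_two_arcs[of "l v"] at_most_two_arcs[of "r v"] l_less_N[OF assms] r_less_N[OF assms]
    by (intro order_trans[OF card_Un_le] add_mono) auto
  finally show ?thesis by simp
qed

end

section \<open>Nested covers\<close>

text \<open>\<open>V0\<close> will consist of the chords that miss the chosen point. For any two of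
  them, the sides that contain the point overlap on the circle; \<open>consistent\<close> records
  this by saying that no two selected arcs cover the circle.\<close>

locale pointed_diagram = oriented_diagram +
  fixes V0 :: "'a set"
  assumes V0_subset: "V0 \<subseteq> V"
    and consistent: "\<lbrakk>u \<in> V0; v \<in> V0\<rbrakk> \<Longrightarrow> \<exists>g\<le>N. \<not> arc u g \<and> \<not> arc v g"
begin

definition covers :: "'a set \<Rightarrow> bool" where
  "covers S \<longleftrightarrow> (\<forall>g\<le>N. \<exists>v\<in>S. arc v g)"

definition maximal_in :: "'a set \<Rightarrow> 'a \<Rightarrow> bool" where
  "maximal_in S e \<longleftrightarrow> e \<in> S \<and> (\<forall>u\<in>S. \<not> {g. g \<le> N \<and> arc e g} \<subset> {g. g \<le> N \<and> arc u g})"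

text \<open>Among the arcs through \<open>g\<close> take one with the most gaps. Any larger arc
  passes through \<open>g\<close> too, so the chosen arc is maximal in all of
  \<open>S\<close>.\<close>

lemma maximal_covers:
  assumes "finite S" "covers S" shows "covers {e. maximal_in S e}"
  unfolding covers_def
proof (intro allI impI)
  fix g assume "g \<le> N"
  let ?A = "\<lambda>v. {g. g \<le> N \<and> arc v g}"
  let ?T = "{v \<in> S. arc v g}"
  have "finite ?T" "?T \<noteq> {}" using assms \<open>g \<le> N\<close> by (auto simp: covers_def)
  then obtain e where e: "e \<in> ?T" "\<forall>u\<in>?T. card (?A u) \<le> card (?A e)"
    using Max_in[of "(\<lambda>u. card (?A u)) ` ?T"] Max_ge[of "(\<lambda>u. card (?A u)) ` ?T"]
    by (smt (verit) finite_imageI image_iff image_is_empty)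
  have "maximal_in S e"
    unfolding maximal_in_def
  proof (intro conjI ballI notI)
    fix u assume "u \<in> S" "?A e \<subset> ?A u"
    then have "u \<in> ?T" using e \<open>g \<le> N\<close> by auto
    moreover have "card (?A e) < card (?A u)"
      using \<open>?A e \<subset> ?A u\<close> by (intro psubset_card_mono) auto
    ultimately show False using e by (meson not_le)
  qed (use e in auto)
  then show "\<exists>v\<in>{e. maximal_in S e}. arc v g" using e by blast
qed

text \<open>Choose a minimal one among the covers by maximal arcs. Minimality gives the private
  gaps, and \<open>consistent\<close> rules out covers by one or two arcs.\<close>

lemma exists_minimal_cover:
  assumes "S \<subseteq> V0" "covers S"
  shows "\<exists>M\<subseteq>S. covers M \<and> (\<forall>e\<in>M. maximal_in S e) \<and> minimal_cover V l r N inner M"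
proof -
  have fin: "finite S" using assms V0_subset finite_V by (meson finite_subset)
  let ?X = "{e. maximal_in S e}"
  have X: "?X \<subseteq> S" "finite ?X" "covers ?X"
    using maximal_covers[OF fin assms(2)] fin by (auto simp: maximal_in_def)
  let ?F = "{M. M \<subseteq> ?X \<and> covers M}"
  have "finite ?F" "?F \<noteq> {}" using X by auto
  then obtain M where M: "M \<in> ?F" "\<forall>M'\<in>?F. M' \<subseteq> M \<longrightarrow> M' = M"
    using finite_has_minimal by (metis (no_types, lifting))
  have cov: "covers M" and sub: "M \<subseteq> V0" "finite M"
    using M X assms fin by (auto intro: finite_subset)
  have "minimal_cover V l r N inner M"
  proof unfold_locales
    show "M \<subseteq> V" using sub V0_subset by blast
    show "\<exists>v\<in>M. arc v g" if "g \<le> N" for g using cov that by (auto simp: covers_def)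
    show "\<exists>g\<le>N. \<forall>u\<in>M. arc u g \<longrightarrow> u = v" if "v \<in> M" for v
    proof -
      have "\<not> covers (M - {v})" using M that by blast
      then show ?thesis by (auto simp: covers_def)
    qed
    show "3 \<le> card M"
    proof (rule ccontr)
      assume "\<not> 3 \<le> card M"
      then consider "card M = 0" | "card M = 1" | "card M = 2" by linarith
      then obtain u v where "M \<subseteq> {u, v}" "u \<in> M" "v \<in> M"
      proof cases
        case 1
        then have "M = {}" using sub by simp
        then show ?thesis using cov by (auto simp: covers_def)
      next
        case 2
        then show ?thesis using that by (auto simp: card_1_singleton_iff)
      next
        case 3
        then show ?thesis using that by (auto simp: card_2_iff)
      qed
      then show False using consistent[of u v] sub cov by (auto simp: covers_def)
    qed
  qed
  then show ?thesis using M X cov by blast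
qed

text \<open>An arc through both ends of \<open>e\<close> contains the arc of \<open>e\<close> or its
  complement, and \<open>consistent\<close> excludes the complement.\<close>

lemma arc_psubset:
  assumes "e \<in> V0" "a \<in> V0" "e \<noteq> a" "arc a (l e)" "arc a (r e)"
  shows "{g. g \<le> N \<and> arc e g} \<subset> {g. g \<le> N \<and> arc a g}"
proof -
  have pos: "l e < r e" "l a < r a" "r e < N" "r a < N" "l e \<noteq> r a" "l a \<noteq> r e" "l e \<noteq> l a" "r e \<noteq> r a"
    using assms(1-3) V0_subset by (simp_all add: subset_eq l_less_r r_less_N l_neq_r l_eq_iff r_eq_iff l_neq_r[symmetric])
  obtain g where g: "g \<le> N" "\<not> arc e g" "\<not> arc a g" using consistent assms by blast
  have "arc a h" if "h \<le> N" "arc e h" for h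
    using g pos(1,2) assms(4,5) that unfolding arc_def between_def
    by (cases "inner e"; cases "inner a") auto
  then have "{g. g \<le> N \<and> arc e g} \<subseteq> {g. g \<le> N \<and> arc a g}" by blast
  \<comment> \<open>Strictness shows at position \<open>l e\<close>: of the two gaps around it
    exactly one belongs to the arc of \<open>e\<close>, while both belong to the arc of
    \<open>a\<close>.\<close>
  moreover have "l e \<le> N" "Suc (l e) \<le> N" "arc e (l e) \<noteq> arc e (Suc (l e))" "arc a (Suc (l e))"
    using pos assms(4,5) unfolding arc_def between_def by auto
  ultimately show ?thesis using assms(4) by (metis (mono_tags, lifting) mem_Collect_eq psubsetI)
qed

text \<open>A member of \<open>M\<close> that covers the gap \<open>l e\<close> cannot contain the
  gap \<open>r e\<close> as well, since its arc would properly contain the maximal arc of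
  \<open>e\<close>; so it crosses \<open>e\<close>. By symmetry, a member that covers
  \<open>r e\<close> is a second chord crossing \<open>e\<close>.\<close>

lemma two_crossings:
  assumes "S \<subseteq> V0" "maximal_in S e" "M \<subseteq> S - {e}" "covers M"
  shows "card {w \<in> M. crosses e w} \<ge> 2"
proof -
  have e: "e \<in> V" "e \<in> S" using assms V0_subset by (auto simp: maximal_in_def)
  obtain a b where a: "a \<in> M" "arc a (l e)" and b: "b \<in> M" "arc b (r e)"
    using \<open>covers M\<close> l_less_N[OF e(1)] r_less_N[OF e(1)] unfolding covers_def
    by (meson order_less_imp_le)
  have "\<not> arc a (r e)" "\<not> arc b (l e)"
    using arc_psubset[of e a] arc_psubset[of e b] a b assms e unfolding maximal_in_def by blast+
  then have "a \<noteq> b" "crosses e a" "crosses e b"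
    using a b e assms crosses_iff_arc[of a e] crosses_iff_arc[of b e] crosses_sym[of e] V0_subset by blast+
  then have "{a, b} \<subseteq> {w \<in> M. crosses e w}" "card {a, b} = 2" using a b by auto
  moreover have "finite {w \<in> M. crosses e w}"
    using assms V0_subset finite_V by (auto intro: finite_subset)
  ultimately show ?thesis by (metis card_mono)
qed

text \<open>Covers are peeled off one by one. Each has at most two arcs over any gap, so the depth
  drops by at most two; its members are maximal among the chords left at that time, so they cross
  every later cover at least twice.\<close>

lemma nested_covers:
  assumes "S \<subseteq> V0" "\<forall>g\<le>N. 2 * t \<le> card {v \<in> S. arc v g}"
  shows "\<exists>M. (\<forall>i\<in>{1..t}. M i \<subseteq> S \<and> covers (M i) \<and> minimal_cover V l r N inner (M i)) \<and>
    (\<forall>i j. 1 \<le> i \<and> i < j \<and> j \<le> t \<longrightarrow>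
       M i \<inter> M j = {} \<and> (\<forall>v\<in>M i. card {w \<in> M j. crosses v w} \<ge> 2))"
  using assms
proof (induction t arbitrary: S)
  case 0
  then show ?case by auto
next
  case (Suc t)
  have "covers S"
    unfolding covers_def
  proof (intro allI impI)
    fix g assume "g \<le> N"
    then have "card {v \<in> S. arc v g} \<noteq> 0" using Suc.prems(2) by fastforce
    then show "\<exists>v\<in>S. arc v g" by (auto simp: card_eq_0_iff)
  qed
  then obtain M1 where M1: "M1 \<subseteq> S" "covers M1" "\<forall>e\<in>M1. maximal_in S e" "minimal_cover V l r N inner M1"
    using exists_minimal_cover[OF Suc.prems(1)] by blast
  have deep: "\<forall>g\<le>N. 2 * t \<le> card {v \<in> S - M1. arc v g}"
  proof (intro allI impI)
    fix g assume g: "g \<le> N"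
    have "{v \<in> S. arc v g} = {v \<in> S - M1. arc v g} \<union> {v \<in> M1. arc v g}" using M1 by auto
    then have "card {v \<in> S. arc v g} \<le> card {v \<in> S - M1. arc v g} + card {v \<in> M1. arc v g}"
      using card_Un_le[of "{v \<in> S - M1. arc v g}" "{v \<in> M1. arc v g}"] by simp
    moreover have "card {v \<in> M1. arc v g} \<le> 2"
      using minimal_cover.at_most_two_arcs[OF M1(4) g] .
    moreover have "2 * Suc t \<le> card {v \<in> S. arc v g}" using Suc.prems(2) g by blast
    ultimately show "2 * t \<le> card {v \<in> S - M1. arc v g}" by simp
  qed
  obtain M where M': "(\<forall>i\<in>{1..t}. M i \<subseteq> S - M1 \<and> covers (M i) \<and> minimal_cover V l r N inner (M i)) \<and>
    (\<forall>i j. 1 \<le> i \<and> i < j \<and> j \<le> t \<longrightarrow>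
       M i \<inter> M j = {} \<and> (\<forall>v\<in>M i. card {w \<in> M j. crosses v w} \<ge> 2))"
    using Suc.IH[OF subset_trans[OF Diff_subset Suc.prems(1)] deep] by (elim exE)
  note M = conjunct1[OF M'] conjunct2[OF M']
  let ?M = "\<lambda>i. if i = 1 then M1 else M (i - 1)"
  have "?M i \<subseteq> S \<and> covers (?M i) \<and> minimal_cover V l r N inner (?M i)" if "i \<in> {1..Suc t}" for i
  proof (cases "i = 1")
    case False
    then have "i - 1 \<in> {1..t}" using that by auto
    then show ?thesis using M(1) False by auto
  qed (use M1 in auto)
  moreover have "?M i \<inter> ?M j = {} \<and> (\<forall>v\<in>?M i. card {w \<in> ?M j. crosses v w} \<ge> 2)"
    if ij: "1 \<le> i" "i < j" "j \<le> Suc t" for i j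
  proof (cases "i = 1")
    case False
    then have ij': "1 \<le> i - 1 \<and> i - 1 < j - 1 \<and> j - 1 \<le> t" and "j \<noteq> 1" using ij by auto
    with False show ?thesis using M(2)[THEN spec, THEN spec, THEN mp, OF ij'] by simp
  next
    case True
    then have "j - 1 \<in> {1..t}" using ij by auto
    then have Mj: "M (j - 1) \<subseteq> S - M1" "covers (M (j - 1))" using M(1) by auto
    then have "card {w \<in> M (j - 1). crosses v w} \<ge> 2" if "v \<in> M1" for v
      using two_crossings[OF Suc.prems(1), of v "M (j - 1)"] M1(3) that by blast
    then show ?thesis using True ij Mj by auto
  qed
  ultimately show ?case by (intro exI[of _ ?M]) blast
qed

end

section \<open>Tree decompositions from splittings of arcs\<close>

lemma connected_iff_rtrancl:
  assumes "wf_digraph D"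
  shows "Digraph_Component.connected D \<longleftrightarrow> verts D \<noteq> {} \<and>
    (\<forall>u\<in>verts D. \<forall>v\<in>verts D. (u, v) \<in> (arcs_ends D \<union> (arcs_ends D)\<inverse>)\<^sup>*)"
proof -
  have parcs: "parcs (mk_symmetric D) = arcs_ends D \<union> (arcs_ends D)\<inverse>"
    by (auto simp: parcs_mk_symmetric arcs_ends_conv)
  have "wf_digraph (with_proj (mk_symmetric D))"
    using assms by (auto simp: wf_digraph_def parcs_mk_symmetric)
  then show ?thesis
    unfolding connected_def strongly_connected_def
    by (auto simp: wf_digraph.reachable_conv parcs)
qed

lemma connected_restrict_iff:
  assumes "pair_wf_digraph G" "sym (parcs G)"
  shows "Digraph_Component.connected (with_proj G \<restriction> X) \<longleftrightarrow>
    X \<noteq> {} \<and> (\<forall>u\<in>X. \<forall>v\<in>X. (u, v) \<in> (parcs G \<inter> X \<times> X)\<^sup>*)"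
proof -
  have wf: "wf_digraph (with_proj G \<restriction> X)"
    using assms(1) wf_digraph.wellformed_induce_subgraph wf_digraph_wp_iff by blast
  have ends: "arcs_ends (with_proj G \<restriction> X) = parcs G \<inter> X \<times> X"
    by (auto simp: arcs_ends_conv induce_subgraph_def)
  have "(parcs G \<inter> X \<times> X)\<inverse> = parcs G \<inter> X \<times> X"
    using assms(2) by (auto simp: sym_def)
  then show ?thesis by (simp add: connected_iff_rtrancl[OF wf] ends)
qed

lemma connected_with_proj_iff:
  assumes "pair_wf_digraph G" "sym (parcs G)"
  shows "Digraph_Component.connected (with_proj G) \<longleftrightarrow>
    pverts G \<noteq> {} \<and> (\<forall>u\<in>pverts G. \<forall>v\<in>pverts G. (u, v) \<in> (parcs G)\<^sup>*)"
proof -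
  have wf: "wf_digraph (with_proj G)" using assms(1) wf_digraph_wp_iff by blast
  have "(parcs G)\<inverse> = parcs G" using assms(2) by (auto simp: sym_def)
  then show ?thesis by (simp add: connected_iff_rtrancl[OF wf])
qed

lemma rtrancl_insert_connected:
  assumes "\<forall>u\<in>X. \<forall>v\<in>X. (u, v) \<in> R\<^sup>*" "R \<subseteq> R'" "sym R'" "x \<in> X" "(x, n) \<in> R'"
  shows "\<forall>u\<in>insert n X. \<forall>v\<in>insert n X. (u, v) \<in> R'\<^sup>*"
proof -
  have "(u, x) \<in> R'\<^sup>*" if "u \<in> insert n X" for u
  proof (cases "u = n")
    case True
    then show ?thesis using assms(3,5) by (auto simp: sym_def)
  next
    case False
    then show ?thesis using assms(1,2,4) that by (meson insertE rtrancl_mono subsetD)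
  qed
  moreover from this have "(x, u) \<in> R'\<^sup>*" if "u \<in> insert n X" for u
    using assms(3) that by (meson sym_rtrancl symD)
  ultimately show ?thesis by (meson rtrancl_trans)
qed

definition add_leaf :: "'b pair_pre_digraph \<Rightarrow> 'b \<Rightarrow> 'b \<Rightarrow> 'b pair_pre_digraph" where
  "add_leaf T x n = \<lparr>pverts = insert n (pverts T), parcs = parcs T \<union> {(x, n), (n, x)}\<rparr>"

lemma add_leaf_simps [simp]:
  "pverts (add_leaf T x n) = insert n (pverts T)"
  "parcs (add_leaf T x n) = parcs T \<union> {(x, n), (n, x)}"
  by (simp_all add: add_leaf_def)

lemma pair_graph_iff:
  "pair_graph T \<longleftrightarrow> finite (pverts T) \<and> parcs T \<subseteq> pverts T \<times> pverts T \<and> sym (parcs T) \<and> irrefl (parcs T)"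
proof
  assume "pair_graph T"
  then interpret pair_graph T .
  show "finite (pverts T) \<and> parcs T \<subseteq> pverts T \<times> pverts T \<and> sym (parcs T) \<and> irrefl (parcs T)"
    using pair_finite_verts arc_fst_in_verts arc_snd_in_verts pair_sym_arcs pair_no_loops
    by (fastforce simp: symmetric_def irrefl_def)
next
  assume a: "finite (pverts T) \<and> parcs T \<subseteq> pverts T \<times> pverts T \<and> sym (parcs T) \<and> irrefl (parcs T)"
  then have "finite (parcs T)" by (meson finite_SigmaI finite_subset)
  with a show "pair_graph T"
    by unfold_locales (auto simp: symmetric_def irrefl_def)
qed

lemma undirected_tree_singleton: "undirected_tree \<lparr>pverts = {a}, parcs = {}\<rparr>"
proof -
  have "pair_graph \<lparr>pverts = {a}, parcs = {}\<rparr>" by (simp add: pair_graph_iff sym_def irrefl_def)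
  moreover have "Digraph_Component.connected (with_proj \<lparr>pverts = {a}, parcs = {}\<rparr>)"
    by (subst connected_with_proj_iff) (auto simp: pair_wf_digraph_def sym_def)
  moreover have "\<not> subgraph (with_proj C) (with_proj \<lparr>pverts = {a}, parcs = {}\<rparr>)" if C: "cycle_graph C" for C
  proof
    assume "subgraph (with_proj C) (with_proj \<lparr>pverts = {a}, parcs = {}\<rparr>)"
    then have "parcs C = {}" by (auto simp: subgraph_def)
    then show False using C by (fastforce simp: cycle_graph_def)
  qed
  ultimately show ?thesis by (auto simp: undirected_tree_def)
qed

text \<open>The predecessor and the successor of \<open>v\<close> differ because the length is at
  least three. This keeps cycles away from leaves.\<close>

lemma cycle_graph_two_neighbours:
  assumes "cycle_graph C" "v \<in> pverts C"
  shows "\<exists>a b. a \<noteq> b \<and> (v, a) \<in> parcs C \<and> (v, b) \<in> parcs C"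
proof -
  obtain vs where vs: "distinct vs" "length vs \<ge> 3" "pverts C = set vs"
    "parcs C = (\<Union>i<length vs. {(vs ! i, vs ! (Suc i mod length vs)),
                                      (vs ! (Suc i mod length vs), vs ! i)})"
    using assms(1) by (auto simp: cycle_graph_def)
  let ?n = "length vs"
  obtain i where i: "i < ?n" "vs ! i = v" using assms(2) vs(3) by (metis in_set_conv_nth)
  define j where "j = (if i = 0 then ?n - 1 else i - 1)"
  have j: "j < ?n" "Suc j mod ?n = i" using i vs(2) by (auto simp: j_def)
  have "Suc i mod ?n < ?n" using vs(2) by (intro mod_less_divisor) auto
  moreover have "j \<noteq> Suc i mod ?n"
    using i vs(2) by (cases "Suc i = ?n") (auto simp: j_def)
  ultimately have "vs ! j \<noteq> vs ! (Suc i mod ?n)" using vs(1) j by (simp add: nth_eq_iff_index_eq)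
  moreover have "(v, vs ! j) \<in> parcs C" "(v, vs ! (Suc i mod ?n)) \<in> parcs C"
    unfolding vs(4) using i j by blast+
  ultimately show ?thesis by blast
qed

text \<open>A cycle through \<open>n\<close> would give the new leaf two neighbours, and a cycle
  avoiding \<open>n\<close> would already lie in \<open>T\<close>.\<close>

lemma undirected_tree_add_leaf:
  assumes "undirected_tree T" "x \<in> pverts T" "n \<notin> pverts T"
  shows "undirected_tree (add_leaf T x n)"
proof -
  have g: "finite (pverts T)" "parcs T \<subseteq> pverts T \<times> pverts T" "sym (parcs T)" "irrefl (parcs T)"
    using assms(1) by (auto simp: undirected_tree_def pair_graph_iff)
  let ?T = "add_leaf T x n"
  have g': "finite (pverts ?T)" "parcs ?T \<subseteq> pverts ?T \<times> pverts ?T" "sym (parcs ?T)" "irrefl (parcs ?T)"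
    using g assms by (auto simp: sym_def irrefl_def)
  have wf: "pair_wf_digraph T" "pair_wf_digraph ?T"
    using g(2) g'(2) by (auto simp: pair_wf_digraph_def)
  have "\<forall>u\<in>pverts T. \<forall>v\<in>pverts T. (u, v) \<in> (parcs T)\<^sup>*"
    using assms(1) connected_with_proj_iff[OF wf(1) g(3)] by (auto simp: undirected_tree_def)
  then have "\<forall>u\<in>insert n (pverts T). \<forall>v\<in>insert n (pverts T). (u, v) \<in> (parcs ?T)\<^sup>*"
    by (rule rtrancl_insert_connected) (use g'(3) assms(2) in auto)
  then have "Digraph_Component.connected (with_proj ?T)"
    by (subst connected_with_proj_iff[OF wf(2) g'(3)]) simp
  moreover have "\<not> subgraph (with_proj C) (with_proj ?T)" if C: "cycle_graph C" for C
  proof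
    assume "subgraph (with_proj C) (with_proj ?T)"
    then have sub: "pverts C \<subseteq> insert n (pverts T)" "parcs C \<subseteq> parcs ?T" "wf_digraph (with_proj C)"
      by (auto simp: subgraph_def)
    show False
    proof (cases "n \<in> pverts C")
      case True
      have "b = x" if "(n, b) \<in> parcs C" for b
        using that sub(2) g(2) assms(2,3) by auto
      then show False using cycle_graph_two_neighbours[OF C True] by metis
    next
      case False
      have "parcs C \<subseteq> pverts C \<times> pverts C"
        using sub(3) by (fastforce simp: wf_digraph_def)
      then have "parcs C \<subseteq> parcs T" using sub(2) False by auto
      moreover have "pverts C \<subseteq> pverts T" using sub(1) False by auto
      ultimately have "subgraph (with_proj C) (with_proj T)"
        using sub(3) wf(1) wf_digraph_wp_iff[of T] by (auto simp: subgraph_def)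
      then show False using assms(1) C by (auto simp: undirected_tree_def)
    qed
  qed
  ultimately show ?thesis using g' by (auto simp: undirected_tree_def pair_graph_iff)
qed

text \<open>A partial tree decomposition of the vertices \<open>W\<close> placed so far. The
  condition on edges is left out, so that the tree can grow bag by bag.\<close>

definition bag_tree :: "'b pair_pre_digraph \<Rightarrow> ('b \<Rightarrow> 'a set) \<Rightarrow> 'a set \<Rightarrow> bool" where
  "bag_tree T B W \<longleftrightarrow> undirected_tree T \<and> (\<forall>x\<in>pverts T. B x \<subseteq> W) \<and>
     (\<forall>v\<in>W. Digraph_Component.connected (with_proj T \<restriction> {x \<in> pverts T. v \<in> B x}))"

lemma bag_tree_singleton: "bag_tree \<lparr>pverts = {a}, parcs = {}\<rparr> (\<lambda>_. {}) {}"
  by (simp add: bag_tree_def undirected_tree_singleton)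

text \<open>An old vertex of the new bag also lies in the neighbouring bag \<open>B x\<close>, so
  the nodes that hold it stay connected; a vertex outside \<open>W\<close> occurs at the leaf
  alone.\<close>

lemma bag_tree_add_leaf:
  assumes "bag_tree T B W" "x \<in> pverts T" "n \<notin> pverts T" "X \<inter> W \<subseteq> B x"
  shows "bag_tree (add_leaf T x n) (B(n := X)) (W \<union> X)"
proof -
  let ?T = "add_leaf T x n"
  let ?B = "B(n := X)"
  have t: "undirected_tree T" and t': "undirected_tree ?T"
    using assms undirected_tree_add_leaf by (auto simp: bag_tree_def)
  have g: "parcs T \<subseteq> pverts T \<times> pverts T" "sym (parcs T)" "sym (parcs ?T)" "parcs ?T \<subseteq> pverts ?T \<times> pverts ?T"
    using t t' by (auto simp: undirected_tree_def pair_graph_iff)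
  have wf: "pair_wf_digraph T" "pair_wf_digraph ?T"
    using g by (auto simp: pair_wf_digraph_def)
  note conn = connected_restrict_iff[OF wf(1) g(2)] and conn' = connected_restrict_iff[OF wf(2) g(3)]
  have bags: "B y \<subseteq> W" if "y \<in> pverts T" for y using assms(1) that by (auto simp: bag_tree_def)
  have "Digraph_Component.connected (with_proj ?T \<restriction> {y \<in> pverts ?T. v \<in> ?B y})" if "v \<in> W \<union> X" for v
  proof -
    let ?Y = "{y \<in> pverts T. v \<in> B y}" and ?Y' = "{y \<in> pverts ?T. v \<in> ?B y}"
    have old: "?Y \<noteq> {} \<and> (\<forall>u\<in>?Y. \<forall>w\<in>?Y. (u, w) \<in> (parcs T \<inter> ?Y \<times> ?Y)\<^sup>*)" if "v \<in> W"
      using that assms(1) unfolding bag_tree_def conn by blast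
    consider "v \<in> X" "v \<in> W" | "v \<in> X" "v \<notin> W" | "v \<notin> X" "v \<in> W" using that \<open>v \<in> W \<union> X\<close> by blast
    then show ?thesis
    proof cases
      case 1
      then have Y': "?Y' = insert n ?Y" and x: "x \<in> ?Y" using assms by auto
      have "\<forall>u\<in>insert n ?Y. \<forall>w\<in>insert n ?Y. (u, w) \<in> (parcs ?T \<inter> ?Y' \<times> ?Y')\<^sup>*"
      proof (rule rtrancl_insert_connected)
        show "\<forall>u\<in>?Y. \<forall>w\<in>?Y. (u, w) \<in> (parcs T \<inter> ?Y \<times> ?Y)\<^sup>*" using old 1 by blast
        show "sym (parcs ?T \<inter> ?Y' \<times> ?Y')" using g(3) by (auto simp: sym_def)
        show "(x, n) \<in> parcs ?T \<inter> ?Y' \<times> ?Y'" unfolding Y' using x by auto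
      qed (use Y' x in auto)
      then show ?thesis unfolding conn' using Y' by blast
    next
      case 2
      then have "?Y' = {n}" using bags by auto
      then show ?thesis unfolding conn' by auto
    next
      case 3
      then have Y': "?Y' = ?Y" using assms(3) by auto
      have "(parcs T \<inter> ?Y \<times> ?Y)\<^sup>* \<subseteq> (parcs ?T \<inter> ?Y' \<times> ?Y')\<^sup>*"
        unfolding Y' by (intro rtrancl_mono) auto
      then show ?thesis unfolding conn' unfolding Y' using old[OF 3(2)] by blast
    qed
  qed
  then show ?thesis using t' bags by (auto simp: bag_tree_def)
qed

section \<open>Triangulation by scanlines and its tree decomposition\<close>

context chord_diagram
begin

text \<open>The gaps \<open>x\<close> and \<open>y\<close> enclose the positions \<open>x\<close> to
  \<open>y - 1\<close>; these are the chords with an end on the arc cut off by the scanline.\<close>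

definition touching :: "nat \<Rightarrow> nat \<Rightarrow> 'a set" where
  "touching x y = {v \<in> V. l v \<in> {x..<y} \<or> r v \<in> {x..<y}}"

lemma separating_iff:
  assumes "x \<le> y"
  shows "v \<in> separating x y \<longleftrightarrow> v \<in> V \<and> (l v \<in> {x..<y}) \<noteq> (r v \<in> {x..<y})"
  using assms l_less_r[of v] by (auto simp: separating_def between_def)

lemma finite_separating: "finite (separating x y)"
  using finite_V by (simp add: separating_def)

lemma card_filter_V: "card {v \<in> V. P v} = (\<Sum>v\<in>V. of_bool (P v))"
  using finite_V by (simp add: of_bool_def sum.If_cases Int_def)

lemma card_separating: "card (separating x y) = (\<Sum>v\<in>V. of_bool (between v x \<noteq> between v y))"
  unfolding separating_def by (rule card_filter_V)

lemma separating_triangle: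
  "card (separating x z) \<le> card (separating x y) + card (separating y z)"
  unfolding card_separating by (simp flip: sum.distrib) (intro sum_mono, auto)

lemma separating_sym: "separating x y = separating y x"
  by (auto simp: separating_def)

text \<open>In the cyclic order \<open>x\<close>, \<open>z\<close>, \<open>y\<close>,
  \<open>w\<close>, the right-hand side counts crossings with the diagonals of a quadrilateral, the
  left-hand side those with two opposite sides. A chord crossing one of these sides crosses a
  diagonal, and a chord crossing both crosses both diagonals.\<close>

lemma separating_uncross:
  assumes "x < z" "z < y" "w \<le> x \<or> y \<le> w"
  shows "card (separating z y) + card (separating w x) \<le> card (separating x y) + card (separating w z)"
  unfolding card_separating sum.distrib[symmetric]
proof (rule sum_mono)
  fix v
  show "of_bool (between v z \<noteq> between v y) + of_bool (between v w \<noteq> between v x)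
    \<le> (of_bool (between v x \<noteq> between v y) + of_bool (between v w \<noteq> between v z) :: nat)"
    using assms by (cases "between v x"; cases "between v y"; cases "between v z"; cases "between v w")
      (auto simp: between_def)
qed

text \<open>Every chord that meets the triangle crosses exactly two of its sides.\<close>

lemma card_triangle:
  "2 * card (separating x z \<union> separating z y)
     \<le> card (separating x z) + card (separating z y) + card (separating x y)"
proof -
  have "separating x z \<union> separating z y =
      {v \<in> V. between v x \<noteq> between v z \<or> between v z \<noteq> between v y}"
    by (auto simp: separating_def)
  then show ?thesis
    unfolding card_separating sum.distrib[symmetric]
    by (simp add: card_filter_V sum_distrib_left) (intro sum_mono, auto)
qed

text \<open>Induction on the length of the arc. The triangle \<open>x z y\<close> becomes a leaf
  attached to \<open>a\<close>, whose bag holds the chords of the scanline \<open>x y\<close>; the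
  two shorter arcs are then treated in turn, with the new leaf in the role of \<open>a\<close>. Old
  bags are preserved so that the second arc still finds the bag of this leaf.\<close>

lemma extend_bag_tree:
  fixes T :: "nat pair_pre_digraph"
  assumes split: "\<And>x y. \<lbrakk>Suc x < y; y \<le> N; card (separating x y) \<le> k\<rbrakk> \<Longrightarrow>
      \<exists>z. x < z \<and> z < y \<and> card (separating x z) \<le> k \<and> card (separating z y) \<le> k"
    and "x < y" "y \<le> N" "card (separating x y) \<le> k"
    and "bag_tree T B W" "a \<in> pverts T" "separating x y \<subseteq> B a" "W \<inter> touching x y \<subseteq> separating x y"
  shows "\<exists>T' :: nat pair_pre_digraph. \<exists>B'. bag_tree T' B' (W \<union> touching x y) \<and> pverts T \<subseteq> pverts T' \<and>
    (\<forall>b\<in>pverts T. B' b = B b) \<and> (\<forall>b\<in>pverts T' - pverts T. 2 * card (B' b) \<le> 3 * k) \<and>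
    (\<forall>u\<in>touching x y. \<forall>v\<in>touching x y. crosses u v \<longrightarrow> (\<exists>b\<in>pverts T'. u \<in> B' b \<and> v \<in> B' b))"
  using assms(2-)
proof (induction "y - x" arbitrary: x y T B W a rule: less_induct)
  case less
  note xy = less.prems(1-3) and T = less.prems(4-7)
  show ?case
  proof (cases "y = Suc x")
    case True
    \<comment> \<open>At most one chord touches an arc with a single position, and it crosses the
      scanline, so it is already in \<open>W\<close>.\<close>
    have "touching x y = separating x y"
      using True separating_iff[of x y] l_less_r by (fastforce simp: touching_def)
    then have "touching x y \<subseteq> W" using T by (auto simp: bag_tree_def)
    have "u = v" if "u \<in> touching x y" "v \<in> touching x y" for u v
      using that True l_eq_iff[of u v] r_eq_iff[of u v] l_neq_r[of u v] l_neq_r[of v u]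
      by (fastforce simp: touching_def)
    then have "\<not> crosses u v" if "u \<in> touching x y" "v \<in> touching x y" for u v
      using that crosses_irrefl by metis
    with \<open>touching x y \<subseteq> W\<close> show ?thesis
      using T(1) by (intro exI[of _ T] exI[of _ B]) (auto simp: Un_absorb2)
  next
    case False
    then obtain z where z: "x < z" "z < y" "card (separating x z) \<le> k" "card (separating z y) \<le> k"
      using split[of x y] xy by auto
    have fin: "finite (pverts T)" using T(1) by (auto simp: bag_tree_def undirected_tree_def pair_graph_iff)
    then obtain n where n: "n \<notin> pverts T" using ex_new_if_finite infinite_UNIV_nat by blast
    let ?X = "separating x z \<union> separating z y"
    have X: "2 * card ?X \<le> 3 * k" using card_triangle[of x z y] z xy by simp
    note sep = separating_iff[OF less_imp_le[OF z(1)]] separating_iff[OF less_imp_le[OF z(2)]]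
      separating_iff[OF less_imp_le[OF xy(1)]]
    have tou: "touching x y = touching x z \<union> touching z y"
      using z by (auto simp: touching_def)
    have "?X \<subseteq> touching x y" using z by (auto simp: sep touching_def)
    then have leaf: "bag_tree (add_leaf T a n) (B(n := ?X)) (W \<union> ?X)"
      using T n by (intro bag_tree_add_leaf) auto
    \<comment> \<open>A chord touching both halves has one end in each of them, so it crosses both
      new scanlines.\<close>
    have both: "touching x z \<inter> touching z y \<subseteq> separating x z \<inter> separating z y"
      by (auto simp: sep touching_def)
    have only: "separating x y \<inter> touching x z \<subseteq> separating x z"
        "separating x y \<inter> touching z y \<subseteq> separating z y"
        "separating x z \<subseteq> touching x z" "separating z y \<subseteq> touching z y"
      using z by (auto simp: sep touching_def)
    have "(W \<union> ?X) \<inter> touching x z \<subseteq> separating x z" "z - x < y - x" "y - z < y - x"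
      using T(4) tou both only z by (blast, auto)
    note dec = this(2,3) and sub1 = this(1)
    obtain T1 :: "nat pair_pre_digraph" and B1 where T1:
        "bag_tree T1 B1 (W \<union> ?X \<union> touching x z)"
        "insert n (pverts T) \<subseteq> pverts T1" "\<forall>b\<in>insert n (pverts T). B1 b = (B(n := ?X)) b"
        "\<forall>b\<in>pverts T1 - insert n (pverts T). 2 * card (B1 b) \<le> 3 * k"
        "\<forall>u\<in>touching x z. \<forall>v\<in>touching x z. crosses u v \<longrightarrow> (\<exists>b\<in>pverts T1. u \<in> B1 b \<and> v \<in> B1 b)"
      using less.hyps[OF dec(1) z(1) _ z(3) leaf, of n] sub1 z xy by auto
    have sub2: "(W \<union> ?X \<union> touching x z) \<inter> touching z y \<subseteq> separating z y"
      using T(4) tou both only by blast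
    obtain T2 :: "nat pair_pre_digraph" and B2 where T2:
        "bag_tree T2 B2 (W \<union> ?X \<union> touching x z \<union> touching z y)"
        "pverts T1 \<subseteq> pverts T2" "\<forall>b\<in>pverts T1. B2 b = B1 b"
        "\<forall>b\<in>pverts T2 - pverts T1. 2 * card (B2 b) \<le> 3 * k"
        "\<forall>u\<in>touching z y. \<forall>v\<in>touching z y. crosses u v \<longrightarrow> (\<exists>b\<in>pverts T2. u \<in> B2 b \<and> v \<in> B2 b)"
      using less.hyps[OF dec(2) z(2) xy(2) z(4) T1(1), of n] sub2 T1(2,3) by auto
    have Bn: "n \<in> pverts T2" "B2 n = ?X" using T1(2,3) T2(2,3) by auto
    \<comment> \<open>A chord with both ends in one half cannot cross a chord that has no end there.
      So each of the two chords has just one end on its half and crosses that side of the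
      triangle.\<close>
    have mixed: "u \<in> ?X \<and> v \<in> ?X"
      if "u \<in> touching x z - touching z y" "v \<in> touching z y - touching x z" "crosses u v" for u v
    proof -
      have u: "u \<in> V" "x \<le> l u \<and> l u < z \<or> x \<le> r u \<and> r u < z" "l u < z \<or> y \<le> l u" "r u < z \<or> y \<le> r u"
        and v: "v \<in> V" "z \<le> l v \<and> l v < y \<or> z \<le> r v \<and> r v < y" "l v < x \<or> z \<le> l v" "r v < x \<or> z \<le> r v"
        using that(1,2) by (auto simp: touching_def)
      have "\<not> (x \<le> l u \<and> r u < z)" "\<not> (z \<le> l v \<and> r v < y)"
        using u(3,4) v(3,4) that(3) unfolding crosses_def by linarith+
      then have "(x \<le> l u \<and> l u < z) \<noteq> (x \<le> r u \<and> r u < z)" "(z \<le> l v \<and> l v < y) \<noteq> (z \<le> r v \<and> r v < y)"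
        using u(2) v(2) by blast+
      then show ?thesis using u(1) v(1) by (simp add: sep)
    qed
    have "\<exists>b\<in>pverts T2. u \<in> B2 b \<and> v \<in> B2 b"
      if uv: "u \<in> touching x y" "v \<in> touching x y" "crosses u v" for u v
    proof -
      consider "u \<in> touching x z" "v \<in> touching x z" | "u \<in> touching z y" "v \<in> touching z y"
        | "u \<in> touching x z - touching z y" "v \<in> touching z y - touching x z"
        | "v \<in> touching x z - touching z y" "u \<in> touching z y - touching x z"
        using uv tou by blast
      then show ?thesis
      proof cases
        case 1
        then obtain b where "b \<in> pverts T1" "u \<in> B1 b \<and> v \<in> B1 b" using T1(5) uv(3) by blast
        then show ?thesis using T2(2,3) by auto
      next
        case 2
        then show ?thesis using T2(5) uv(3) by blast
      next
        case 3
        then show ?thesis using mixed[of u v] uv Bn by auto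
      next
        case 4
        then show ?thesis using mixed[of v u] uv Bn crosses_sym by auto
      qed
    qed
    moreover have "W \<union> ?X \<union> touching x z \<union> touching z y = W \<union> touching x y"
      using tou \<open>?X \<subseteq> touching x y\<close> by blast
    moreover have "\<forall>b\<in>pverts T2 - pverts T. 2 * card (B2 b) \<le> 3 * k"
    proof
      fix b assume b: "b \<in> pverts T2 - pverts T"
      consider "b \<notin> pverts T1" | "b \<in> pverts T1" "b \<noteq> n" | "b = n" by blast
      then show "2 * card (B2 b) \<le> 3 * k"
        using b T1(4) T2(3,4) Bn X by cases auto
    qed
    moreover have "pverts T \<subseteq> pverts T2" using T1(2) T2(2) by auto
    moreover have "B2 b = B b" if "b \<in> pverts T" for b
      using that T1(2,3) T2(3) n by (metis fun_upd_other insertCI subsetD)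
    ultimately show ?thesis using T2(1) by (intro exI[of _ T2] exI[of _ B2]) auto
  qed
qed

lemma treewidth_le:
  assumes split: "\<And>x y. \<lbrakk>Suc x < y; y \<le> N; card (separating x y) \<le> k\<rbrakk> \<Longrightarrow>
      \<exists>z. x < z \<and> z < y \<and> card (separating x z) \<le> k \<and> card (separating z y) \<le> k"
    and G: "pverts G = V" "\<And>u v. (u, v) \<in> parcs G \<Longrightarrow> u \<in> V \<and> v \<in> V \<and> crosses u v"
  shows "2 * treewidth G \<le> 3 * k"
proof -
  have "\<exists>(T :: nat pair_pre_digraph) B. tree_decomposition G T B \<and> (\<forall>b\<in>pverts T. 2 * card (B b) \<le> 3 * k)"
  proof (cases "V = {}")
    case True
    then show ?thesis
      using bag_tree_singleton[of 0] G
      by (intro exI[of _ "\<lparr>pverts = {0}, parcs = {}\<rparr>"] exI[of _ "\<lambda>_. {}"])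
        (fastforce simp: tree_decomposition_def bag_tree_def)
  next
    case False
    then have "0 < N" using r_less_N by fastforce
    have tou: "touching 0 N = V" using l_less_N by (auto simp: touching_def)
    \<comment> \<open>Gaps \<open>0\<close> and \<open>N\<close> are the same place of the circle.
      The recursion starts from this degenerate scanline, with an empty bag at the root.\<close>
    have sep: "separating 0 N = {}" by (auto simp: separating_def not_between_0 not_between_N)
    have "\<exists>T' :: nat pair_pre_digraph. \<exists>B'. bag_tree T' B' ({} \<union> touching 0 N) \<and>
      pverts \<lparr>pverts = {0 :: nat}, parcs = {}\<rparr> \<subseteq> pverts T' \<and>
      (\<forall>b\<in>pverts \<lparr>pverts = {0 :: nat}, parcs = {}\<rparr>. B' b = {}) \<and>
      (\<forall>b\<in>pverts T' - pverts \<lparr>pverts = {0 :: nat}, parcs = {}\<rparr>. 2 * card (B' b) \<le> 3 * k) \<and>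
      (\<forall>u\<in>touching 0 N. \<forall>v\<in>touching 0 N. crosses u v \<longrightarrow> (\<exists>b\<in>pverts T'. u \<in> B' b \<and> v \<in> B' b))"
      by (rule extend_bag_tree[OF split _ _ _ bag_tree_singleton, where a = 0])
        (use \<open>0 < N\<close> sep in auto)
    then obtain T :: "nat pair_pre_digraph" and B where T: "bag_tree T B V"
        "B 0 = {}" "\<forall>b\<in>pverts T - {0}. 2 * card (B b) \<le> 3 * k"
        "\<forall>u\<in>V. \<forall>v\<in>V. crosses u v \<longrightarrow> (\<exists>b\<in>pverts T. u \<in> B b \<and> v \<in> B b)"
      unfolding tou by auto
    have "2 * card (B b) \<le> 3 * k" if "b \<in> pverts T" for b
      using T(2,3) that by (cases "b = 0") auto
    moreover have "tree_decomposition G T B"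
      using T(1,4) G by (auto simp: tree_decomposition_def bag_tree_def)
    ultimately show ?thesis by blast
  qed
  then obtain T :: "nat pair_pre_digraph" and B where T: "tree_decomposition G T B" "\<forall>b\<in>pverts T. 2 * card (B b) \<le> 3 * k"
    by blast
  have "pair_graph T" "pverts T \<noteq> {}"
    using T(1) by (auto simp: tree_decomposition_def undirected_tree_def connected_def strongly_connected_def)
  then have "finite (pverts T)" by (simp add: pair_graph_iff)
  then have "Max ((\<lambda>x. card (B x)) ` pverts T) \<in> (\<lambda>x. card (B x)) ` pverts T"
    using \<open>pverts T \<noteq> {}\<close> by (intro Max_in) auto
  then have "2 * Max ((\<lambda>x. card (B x)) ` pverts T) \<le> 3 * k"
    using T(2) by auto
  then have "2 * decomposition_width T B \<le> 3 * k" by (simp add: decomposition_width_def)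
  moreover have "treewidth G \<le> decomposition_width T B"
    unfolding treewidth_def using T(1) by (intro Least_le) blast
  ultimately show ?thesis by linarith
qed

end

section \<open>A point far from the boundary, or a splitting\<close>

text \<open>The determinant of three lines \<open>w = (a + b) u - a b\<close>, the chords of the parabola
  \<open>w = u\<^sup>2\<close>; it vanishes if they are concurrent.\<close>

definition chord_det :: "real \<Rightarrow> real \<Rightarrow> real \<Rightarrow> real \<Rightarrow> real \<Rightarrow> real \<Rightarrow> real" where
  "chord_det a b c d e f = (c + d - a - b) * (e * f - a * b) - (e + f - a - b) * (c * d - a * b)"

text \<open>The determinant is affine in \<open>f\<close>, so it has at most one zero unless both
  coefficients vanish. In that case the pairs \<open>a\<close>, \<open>b\<close> and
  \<open>c\<close>, \<open>d\<close> would have the same sum and product and hence coincide.\<close>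

lemma finite_chord_det_zeros:
  assumes "distinct [a, b, c, d, e]"
  shows "finite {f. chord_det a b c d e f = 0}"
proof -
  define \<alpha> where "\<alpha> = (c + d - a - b) * e - (c * d - a * b)"
  define \<beta> where "\<beta> = - (c + d - a - b) * (a * b) - (e - a - b) * (c * d - a * b)"
  have lin: "chord_det a b c d e f = \<alpha> * f + \<beta>" for f
    by (simp add: chord_det_def \<alpha>_def \<beta>_def algebra_simps)
  have "\<alpha> \<noteq> 0 \<or> \<beta> \<noteq> 0"
  proof (rule ccontr)
    assume "\<not> (\<alpha> \<noteq> 0 \<or> \<beta> \<noteq> 0)"
    then have P: "c * d - a * b = (c + d - a - b) * e" and "\<beta> = 0" by (auto simp: \<alpha>_def)
    then have "(c + d - a - b) * ((e - a) * (e - b)) = 0"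
      unfolding \<beta>_def P by (simp add: algebra_simps)
    then have "c + d = a + b" using assms by auto
    moreover from this have "c * d = a * b" using P by simp
    ultimately have "(c - a) * (c - b) = 0" by algebra
    then show False using assms by auto
  qed
  then have "{f. chord_det a b c d e f = 0} \<subseteq> {- \<beta> / \<alpha>}"
    unfolding lin by (cases "\<alpha> = 0") (auto simp: field_simps add_eq_0_iff)
  then show ?thesis using finite_subset by blast
qed

text \<open>These symmetries bring any of the six points into the last place.\<close>

lemma chord_det_swap:
  "chord_det a b c d e f = chord_det a b c d f e"
  "chord_det a b c d e f = - chord_det a b e f c d"
  "chord_det a b c d e f = - chord_det e f c d a b"
  by (simp_all add: chord_det_def algebra_simps)

text \<open>Positions are chosen one after the other. Every choice of five earlier points forbids
  only finitely many values, while the open unit interval is infinite.\<close>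

lemma exists_generic_positions:
  "\<exists>\<tau> :: nat \<Rightarrow> real. (\<forall>i<n. real i < \<tau> i \<and> \<tau> i < real i + 1) \<and>
     (\<forall>i j k l p q. distinct [i, j, k, l, p, q] \<and> {i, j, k, l, p, q} \<subseteq> {..<n} \<longrightarrow>
        chord_det (\<tau> i) (\<tau> j) (\<tau> k) (\<tau> l) (\<tau> p) (\<tau> q) \<noteq> 0)"
proof (induction n)
  case 0
  then show ?case by simp
next
  case (Suc n)
  then obtain \<tau> :: "nat \<Rightarrow> real" where \<tau>: "\<forall>i<n. real i < \<tau> i \<and> \<tau> i < real i + 1"
    and gen: "\<forall>i j k l p q. distinct [i, j, k, l, p, q] \<and> {i, j, k, l, p, q} \<subseteq> {..<n} \<longrightarrow>
        chord_det (\<tau> i) (\<tau> j) (\<tau> k) (\<tau> l) (\<tau> p) (\<tau> q) \<noteq> 0"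
    by blast
  have inj: "\<tau> i \<noteq> \<tau> j" if "i < n" "j < n" "i \<noteq> j" for i j
  proof -
    have "real i + 1 \<le> real j \<or> real j + 1 \<le> real i" using \<open>i \<noteq> j\<close> by linarith
    then show ?thesis using \<tau> that by (metis less_eq_real_def not_le order_less_trans)
  qed
  let ?I = "{xs. set xs \<subseteq> {..<n} \<and> length xs = 5} \<inter> {xs. distinct xs}"
  let ?Z = "\<lambda>xs. {f. chord_det (\<tau> (xs ! 0)) (\<tau> (xs ! 1)) (\<tau> (xs ! 2)) (\<tau> (xs ! 3)) (\<tau> (xs ! 4)) f = 0}"
  have "finite (\<Union>xs\<in>?I. ?Z xs)"
  proof (rule finite_UN_I)
    show "finite ?I" using finite_lists_length_eq[of "{..<n}" 5] by auto
    fix xs assume "xs \<in> ?I"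
    then have xs: "set xs \<subseteq> {..<n}" "length xs = 5" "distinct xs" by auto
    have "\<tau> (xs ! i) \<noteq> \<tau> (xs ! j)" if "i < 5" "j < 5" "i \<noteq> j" for i j
    proof (rule inj)
      have "xs ! i \<in> set xs" "xs ! j \<in> set xs" using that xs(2) by simp_all
      then show "xs ! i < n" "xs ! j < n" using xs(1) by auto
      show "xs ! i \<noteq> xs ! j" using xs that by (simp add: nth_eq_iff_index_eq)
    qed
    then show "finite (?Z xs)" by (intro finite_chord_det_zeros) simp
  qed
  moreover have "infinite {real n<..<real n + 1}" by (rule infinite_Ioo) simp
  ultimately obtain x where x: "x \<in> {real n<..<real n + 1}" "x \<notin> (\<Union>xs\<in>?I. ?Z xs)"
    by (meson finite_subset subsetI)
  have new: "chord_det (\<tau> i) (\<tau> j) (\<tau> k) (\<tau> l) (\<tau> p) x \<noteq> 0"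
    if "distinct [i, j, k, l, p]" "{i, j, k, l, p} \<subseteq> {..<n}" for i j k l p
  proof -
    have "[i, j, k, l, p] \<in> ?I" using that by simp
    then have "x \<notin> ?Z [i, j, k, l, p]" using x(2) by blast
    then show ?thesis by (simp add: numeral_eq_Suc)
  qed
  let ?\<tau> = "\<tau>(n := x)"
  have last: "chord_det (?\<tau> i) (?\<tau> j) (?\<tau> k) (?\<tau> l) (?\<tau> p) (?\<tau> q) \<noteq> 0"
    if "distinct [i, j, k, l, p, q]" "{i, j, k, l, p} \<subseteq> {..n}" "q = n" for i j k l p q
  proof -
    have "i \<noteq> n" "j \<noteq> n" "k \<noteq> n" "l \<noteq> n" "p \<noteq> n" using that by auto
    moreover from this have "{i, j, k, l, p} \<subseteq> {..<n}" using that(2) le_neq_implies_less by simp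
    moreover have "distinct [i, j, k, l, p]" using that(1) by simp
    ultimately show ?thesis using new[of i j k l p] that(3) by simp
  qed
  have "chord_det (?\<tau> i) (?\<tau> j) (?\<tau> k) (?\<tau> l) (?\<tau> p) (?\<tau> q) \<noteq> 0"
    if d: "distinct [i, j, k, l, p, q]" and s: "{i, j, k, l, p, q} \<subseteq> {..<Suc n}" for i j k l p q
  proof -
    note sw = chord_det_swap(1)[of "?\<tau> i" "?\<tau> j" "?\<tau> k" "?\<tau> l" "?\<tau> p" "?\<tau> q"]
      chord_det_swap(2)[of "?\<tau> i" "?\<tau> j" "?\<tau> k" "?\<tau> l" "?\<tau> p" "?\<tau> q"]
      chord_det_swap(3)[of "?\<tau> i" "?\<tau> j" "?\<tau> k" "?\<tau> l" "?\<tau> p" "?\<tau> q"]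
      chord_det_swap(1)[of "?\<tau> i" "?\<tau> j" "?\<tau> p" "?\<tau> q" "?\<tau> k" "?\<tau> l"]
      chord_det_swap(1)[of "?\<tau> p" "?\<tau> q" "?\<tau> k" "?\<tau> l" "?\<tau> i" "?\<tau> j"]
    have le: "i \<le> n" "j \<le> n" "k \<le> n" "l \<le> n" "p \<le> n" "q \<le> n" using s by auto
    consider "q = n" | "p = n" | "l = n" | "k = n" | "j = n" | "i = n" | "n \<notin> {i, j, k, l, p, q}" by blast
    then show ?thesis
    proof cases
      case 1
      then show ?thesis using last[of i j k l p q] d le by auto
    next
      case 2
      then show ?thesis using last[of i j k l q p] d le sw(1) by auto
    next
      case 3
      then show ?thesis using last[of i j p q k l] d le sw(2) by auto
    next
      case 4
      then show ?thesis using last[of i j p q l k] d le sw(2,4) by auto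
    next
      case 5
      then show ?thesis using last[of p q k l i j] d le sw(3) by auto
    next
      case 6
      then show ?thesis using last[of p q k l j i] d le sw(3,5) by auto
    next
      case 7
      then have "{i, j, k, l, p, q} \<subseteq> {..<n}" using le le_neq_implies_less by simp
      then have "chord_det (\<tau> i) (\<tau> j) (\<tau> k) (\<tau> l) (\<tau> p) (\<tau> q) \<noteq> 0" using gen d by blast
      then show ?thesis using 7 by simp
    qed
  qed
  moreover have "\<forall>i<Suc n. real i < ?\<tau> i \<and> ?\<tau> i < real i + 1"
    using \<tau> x(1) by (auto simp: less_Suc_eq)
  ultimately show ?case by (intro exI[of _ ?\<tau>]) blast
qed

text \<open>The parabola plays the part of the circle. Gap \<open>g\<close> has abscissa
  \<open>g\<close>, just to the left of position \<open>g\<close>, whose abscissa lies strictly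
  between \<open>g\<close> and \<open>g + 1\<close>.\<close>

definition gap_point :: "nat \<Rightarrow> real \<times> real" where
  "gap_point g = (real g, (real g)\<^sup>2)"

section \<open>The diagram drawn in the plane with no three concurrent chords\<close>

locale drawn_diagram = chord_diagram +
  fixes \<tau> :: "nat \<Rightarrow> real"
  assumes \<tau>: "i < N \<Longrightarrow> real i < \<tau> i \<and> \<tau> i < real i + 1"
    and generic: "\<lbrakk>distinct [i, j, k, h, p, q]; {i, j, k, h, p, q} \<subseteq> {..<N}\<rbrakk> \<Longrightarrow>
        chord_det (\<tau> i) (\<tau> j) (\<tau> k) (\<tau> h) (\<tau> p) (\<tau> q) \<noteq> 0"
begin

text \<open>An affine function that vanishes on the line of the chord; it is negative below this
  line, where the parabola runs between the two ends.\<close>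

definition side :: "'a \<Rightarrow> real \<times> real \<Rightarrow> real" where
  "side v p = snd p - (\<tau> (l v) + \<tau> (r v)) * fst p + \<tau> (l v) * \<tau> (r v)"

text \<open>The inequality is strict, so a chord through \<open>p\<close> separates \<open>p\<close>
  from no gap; this makes the regions closed.\<close>

definition separated :: "real \<times> real \<Rightarrow> nat \<Rightarrow> 'a set" where
  "separated p g = {v \<in> V. side v p * side v (gap_point g) < 0}"

definition disc :: "(real \<times> real) set" where
  "disc = convex hull (gap_point ` {..N})"

definition region :: "nat \<Rightarrow> nat \<Rightarrow> (real \<times> real) set" where
  "region d g = {p \<in> disc. card (separated p g) \<le> d}"

lemma \<tau>_less_iff: "\<lbrakk>i < N; j < N\<rbrakk> \<Longrightarrow> \<tau> i < \<tau> j \<longleftrightarrow> i < j"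
  using \<tau>[of i] \<tau>[of j] by (cases i j rule: linorder_cases) auto

lemma \<tau>_less_real_iff: "i < N \<Longrightarrow> \<tau> i < real g \<longleftrightarrow> i < g"
  using \<tau>[of i] by auto

lemma \<tau>_neq_real: "i < N \<Longrightarrow> \<tau> i \<noteq> real g"
  using \<tau>[of i] by auto

lemma side_gap_point: "side v (gap_point g) = (real g - \<tau> (l v)) * (real g - \<tau> (r v))"
  by (simp add: side_def gap_point_def algebra_simps power2_eq_square)

lemma side_gap_point_neq_0: "v \<in> V \<Longrightarrow> side v (gap_point g) \<noteq> 0"
  using \<tau>_neq_real[OF l_less_N] \<tau>_neq_real[OF r_less_N] by (simp add: side_gap_point) metis

lemma side_gap_point_neg_iff: "v \<in> V \<Longrightarrow> side v (gap_point g) < 0 \<longleftrightarrow> between v g"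
proof -
  assume v: "v \<in> V"
  have "\<tau> (l v) < real g \<longleftrightarrow> l v < g" "\<tau> (r v) < real g \<longleftrightarrow> r v < g" "l v < r v"
    using v \<tau>_less_real_iff l_less_N r_less_N l_less_r by auto
  moreover have "\<tau> (r v) \<noteq> real g" using v \<tau>_neq_real r_less_N by blast
  ultimately show ?thesis
    unfolding side_gap_point mult_less_0_iff between_def by auto
qed

lemma separated_gap_point: "separated (gap_point x) y = separating x y"
proof -
  have "side v (gap_point x) * side v (gap_point y) < 0 \<longleftrightarrow> between v x \<noteq> between v y" if "v \<in> V" for v
    using side_gap_point_neg_iff[OF that, of x] side_gap_point_neg_iff[OF that, of y]
      side_gap_point_neq_0[OF that, of x] side_gap_point_neq_0[OF that, of y]
    by (auto simp: mult_less_0_iff)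
  then show ?thesis by (auto simp: separated_def separating_def)
qed

lemma separating_self: "separating x x = {}"
  by (simp add: separating_def)

lemma finite_separated: "finite (separated p g)"
  using finite_V by (simp add: separated_def)

lemma gap_point_in_disc: "g \<le> N \<Longrightarrow> gap_point g \<in> disc"
  by (auto simp: disc_def intro: hull_inc)

lemma region_subset: "region d g \<subseteq> disc"
  by (auto simp: region_def)

lemma gap_point_in_region: "x \<le> N \<Longrightarrow> gap_point x \<in> region d y \<longleftrightarrow> card (separating x y) \<le> d"
  by (simp add: region_def gap_point_in_disc separated_gap_point)

lemma disc_above_parabola:
  assumes "p \<in> disc" shows "(fst p)\<^sup>2 \<le> snd p"
proof -
  have "convex {p :: real \<times> real. (fst p)\<^sup>2 \<le> snd p}"
  proof (rule convexI)
    fix p q :: "real \<times> real" and a b :: real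
    assume pq: "p \<in> {p. (fst p)\<^sup>2 \<le> snd p}" "q \<in> {p. (fst p)\<^sup>2 \<le> snd p}" and ab: "0 \<le> a" "0 \<le> b" "a + b = 1"
    have b: "b = 1 - a" using ab by simp
    have "a * (fst p)\<^sup>2 + b * (fst q)\<^sup>2 - (a * fst p + b * fst q)\<^sup>2 = a * b * (fst p - fst q)\<^sup>2"
      unfolding b by (simp add: power2_eq_square algebra_simps)
    then have "(a * fst p + b * fst q)\<^sup>2 \<le> a * (fst p)\<^sup>2 + b * (fst q)\<^sup>2"
      using ab by (smt (verit) mult_nonneg_nonneg zero_le_power2)
    also have "\<dots> \<le> a * snd p + b * snd q"
      using pq ab by (intro add_mono mult_left_mono) auto
    finally show "a *\<^sub>R p + b *\<^sub>R q \<in> {p. (fst p)\<^sup>2 \<le> snd p}" by simp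
  qed
  then have "disc \<subseteq> {p. (fst p)\<^sup>2 \<le> snd p}"
    unfolding disc_def by (intro hull_minimal) (auto simp: gap_point_def)
  then show ?thesis using assms by auto
qed

lemma continuous_on_side: "continuous_on A (side v)"
  unfolding side_def by (intro continuous_intros)

lemma compact_disc: "compact disc"
  unfolding disc_def by (intro compact_convex_hull finite_imp_compact) simp

lemma convex_disc: "convex disc"
  unfolding disc_def by (rule convex_convex_hull)

text \<open>The region is a finite union over the sets \<open>S\<close> of at most \<open>d\<close>
  chords that may separate; each part is cut out of the disc by closed half-planes, one for every
  chord outside \<open>S\<close>.\<close>

lemma closed_region: "closed (region d g)"
proof -
  let ?F = "{S \<in> Pow V. card S \<le> d}"
  have "region d g = disc \<inter> (\<Union>S\<in>?F. \<Inter>v\<in>V - S. {p. 0 \<le> side v p * side v (gap_point g)})"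
  proof (intro set_eqI iffI)
    fix p assume p: "p \<in> region d g"
    then have "separated p g \<in> ?F" by (auto simp: region_def separated_def)
    moreover have "p \<in> (\<Inter>v\<in>V - separated p g. {p. 0 \<le> side v p * side v (gap_point g)})"
      by (auto simp: separated_def)
    ultimately show "p \<in> disc \<inter> (\<Union>S\<in>?F. \<Inter>v\<in>V - S. {p. 0 \<le> side v p * side v (gap_point g)})"
      using p by (auto simp: region_def)
  next
    fix p assume "p \<in> disc \<inter> (\<Union>S\<in>?F. \<Inter>v\<in>V - S. {p. 0 \<le> side v p * side v (gap_point g)})"
    then obtain S where S: "p \<in> disc" "S \<subseteq> V" "card S \<le> d"
      "\<forall>v\<in>V - S. 0 \<le> side v p * side v (gap_point g)" by blast
    then have "separated p g \<subseteq> S" by (force simp: separated_def)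
    then have "card (separated p g) \<le> card S" using S(2) finite_V by (meson card_mono finite_subset)
    then show "p \<in> region d g" using S by (simp add: region_def)
  qed
  moreover have "closed {p. 0 \<le> side v p * side v (gap_point g)}" for v
    by (intro closed_Collect_le continuous_intros continuous_on_side)
  ultimately show ?thesis
    using finite_V compact_imp_closed[OF compact_disc] by (auto intro!: closed_Int closed_UN closed_INT)
qed

lemma side_convex: "side v ((1 - u) *\<^sub>R p + u *\<^sub>R q) = (1 - u) * side v p + u * side v q"
  by (simp add: side_def algebra_simps)

text \<open>On the way from a point to the gap point no chord begins to separate, so the region is
  star-shaped about the gap point.\<close>

lemma connected_region:
  assumes "g \<le> N" shows "topological_space_class.connected (region d g)"
proof (rule starlike_imp_connected)
  have "closed_segment (gap_point g) p \<subseteq> region d g" if p: "p \<in> region d g" for p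
  proof
    fix q assume q: "q \<in> closed_segment (gap_point g) p"
    then obtain u where u: "0 \<le> u" "u \<le> 1" "q = (1 - u) *\<^sub>R gap_point g + u *\<^sub>R p"
      by (auto simp: in_segment)
    have "separated q g \<subseteq> separated p g"
    proof
      fix v assume "v \<in> separated q g"
      then have v: "v \<in> V" "side v q * side v (gap_point g) < 0" by (auto simp: separated_def)
      let ?z = "side v (gap_point g)"
      have "side v q * ?z = (1 - u) * (?z * ?z) + u * (side v p * ?z)"
        unfolding u(3) side_convex by (simp add: algebra_simps)
      moreover have "0 \<le> (1 - u) * (?z * ?z)" using u by simp
      ultimately have "u * (side v p * ?z) < 0" using v by linarith
      then have "side v p * ?z < 0" using u(1) by (simp add: mult_less_0_iff)
      then show "v \<in> separated p g" using v by (simp add: separated_def)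
    qed
    then have "card (separated q g) \<le> card (separated p g)" by (intro card_mono finite_separated)
    moreover have "q \<in> disc"
      using q p convex_disc gap_point_in_disc[OF assms] region_subset
      by (meson closed_segment_subset subsetD)
    ultimately show "q \<in> region d g" using p by (simp add: region_def)
  qed
  moreover have "gap_point g \<in> region d g"
    using assms by (simp add: gap_point_in_region separating_self)
  ultimately show "starlike (region d g)" unfolding starlike_def by blast
qed

text \<open>Eliminating \<open>p\<close> from three equations \<open>side v p = 0\<close> makes
  \<open>chord_det\<close> vanish, against \<open>generic\<close>.\<close>

lemma card_through: "card {v \<in> V. side v p = 0} \<le> 2"
proof (rule ccontr)
  assume "\<not> ?thesis"
  then have "3 \<le> card {v \<in> V. side v p = 0}" by simp
  then obtain W where W: "W \<subseteq> {v \<in> V. side v p = 0}" "card W = 3"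
    by (meson obtain_subset_with_card_n)
  then obtain a b c where abc: "W = {a, b, c}" "a \<noteq> b" "b \<noteq> c" "a \<noteq> c"
    by (auto simp: card_3_iff)
  have V: "a \<in> V" "b \<in> V" "c \<in> V" and 0: "side a p = 0" "side b p = 0" "side c p = 0"
    using W abc by auto
  have "distinct [l a, r a, l b, r b, l c, r c]"
    using V abc l_less_r by (auto simp: l_eq_iff r_eq_iff l_neq_r l_neq_r[symmetric])
  moreover have "{l a, r a, l b, r b, l c, r c} \<subseteq> {..<N}" using V l_less_N r_less_N by auto
  ultimately have "chord_det (\<tau> (l a)) (\<tau> (r a)) (\<tau> (l b)) (\<tau> (r b)) (\<tau> (l c)) (\<tau> (r c)) \<noteq> 0"
    by (rule generic)
  moreover have "\<tau> (l b) * \<tau> (r b) - \<tau> (l a) * \<tau> (r a) = (\<tau> (l b) + \<tau> (r b) - \<tau> (l a) - \<tau> (r a)) * fst p"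
    "\<tau> (l c) * \<tau> (r c) - \<tau> (l a) * \<tau> (r a) = (\<tau> (l c) + \<tau> (r c) - \<tau> (l a) - \<tau> (r a)) * fst p"
    using 0 by (simp_all add: side_def algebra_simps)
  ultimately show False by (simp add: chord_det_def)
qed

text \<open>A chord between \<open>x\<close> and \<open>y\<close> separates \<open>p\<close> from
  one of them or passes through \<open>p\<close>.\<close>

lemma regions_meet:
  assumes "p \<in> region d x" "p \<in> region d y"
  shows "card (separating x y) \<le> 2 * d + 2"
proof -
  have "separating x y \<subseteq> separated p x \<union> separated p y \<union> {v \<in> V. side v p = 0}"
  proof
    fix v assume "v \<in> separating x y"
    then have v: "v \<in> V" "side v (gap_point x) * side v (gap_point y) < 0"
      by (auto simp: separated_gap_point[symmetric] separated_def)
    then show "v \<in> separated p x \<union> separated p y \<union> {v \<in> V. side v p = 0}"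
      by (auto simp: separated_def mult_less_0_iff not_less)
  qed
  then have "card (separating x y) \<le> card (separated p x \<union> separated p y \<union> {v \<in> V. side v p = 0})"
    using finite_separated finite_V by (intro card_mono) auto
  also have "\<dots> \<le> card (separated p x) + card (separated p y) + card {v \<in> V. side v p = 0}"
    by (meson add_right_mono card_Un_le order_trans)
  also have "\<dots> \<le> d + d + 2"
    using assms card_through[of p] by (intro add_mono) (auto simp: region_def)
  finally show ?thesis by simp
qed

lemma card_separating_Suc: "card (separating x (Suc x)) \<le> 1"
proof -
  have "u = v" if "u \<in> separating x (Suc x)" "v \<in> separating x (Suc x)" for u v
    using that l_eq_iff[of u v] r_eq_iff[of u v] l_neq_r[of u v] l_neq_r[of v u]
    by (auto simp: separating_iff)
  then show ?thesis
    by (metis One_nat_def card_le_Suc0_iff_eq finite_separating)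
qed

text \<open>The point of gap \<open>b\<close> lies in the regions of both \<open>b\<close> and
  \<open>Suc b\<close>, since at most one chord separates these gaps and \<open>d\<close> is
  positive.\<close>

lemma connected_regions:
  assumes "1 \<le> d" "b \<le> N" "a \<le> b"
  shows "topological_space_class.connected (\<Union>g\<in>{a..b}. region d g)"
  using assms(3,2)
proof (induction b rule: dec_induct)
  case base
  then show ?case using connected_region by simp
next
  case (step b)
  have "topological_space_class.connected ((\<Union>g\<in>{a..b}. region d g) \<union> region d (Suc b))"
  proof (rule connected_Un)
    have "gap_point b \<in> region d b" "gap_point b \<in> region d (Suc b)"
      using step.prems card_separating_Suc[of b] assms(1) by (auto simp: gap_point_in_region separating_self)
    then show "(\<Union>g\<in>{a..b}. region d g) \<inter> region d (Suc b) \<noteq> {}" using step.hyps by fastforce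
  qed (use step connected_region in auto)
  then show ?case using step.hyps by (simp add: atLeastAtMostSuc_conv Un_commute)
qed

text \<open>\<open>I\<close> collects the regions of the gaps inside the arc and \<open>R\<close>
  those of the others; by unicoherence they meet in a connected set. The inner gaps with a light
  scanline to \<open>x\<close> (\<open>?P\<close>) and those with a light scanline to
  \<open>y\<close> (\<open>?Q\<close>) have regions that cover this set and both meet it, so they
  share a point there, which forces a common gap.\<close>

lemma exists_split:
  assumes d: "1 \<le> d" and cover: "\<And>p. p \<in> disc \<Longrightarrow> \<exists>g\<le>N. p \<in> region d g"
    and xy: "Suc x < y" "y \<le> N" "card (separating x y) \<le> 4 * d + 4"
  shows "\<exists>z. x < z \<and> z < y \<and> card (separating x z) \<le> 4 * d + 4 \<and> card (separating z y) \<le> 4 * d + 4"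
proof -
  define I where "I = (\<Union>g\<in>{Suc x..y - 1}. region d g)"
  define R where "R = (\<Union>g\<in>{y..N}. region d g) \<union> (\<Union>g\<in>{0..x}. region d g)"
  have "topological_space_class.connected I" unfolding I_def using xy d by (intro connected_regions) auto
  have "topological_space_class.connected R" unfolding R_def
  proof (rule connected_Un)
    \<comment> \<open>The two ranges of outer gaps are joined across the cut, where gaps
      \<open>N\<close> and \<open>0\<close> coincide.\<close>
    have "separating 0 N = {}" by (auto simp: separating_def not_between_0 not_between_N)
    then have "gap_point 0 \<in> region d N" "gap_point 0 \<in> region d 0"
      by (auto simp: gap_point_in_region separating_self)
    then show "(\<Union>g\<in>{y..N}. region d g) \<inter> (\<Union>g\<in>{0..x}. region d g) \<noteq> {}" using xy by fastforce
  qed (use xy d in \<open>auto intro: connected_regions\<close>)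
  have "closed I" "closed R" unfolding I_def R_def by (auto intro!: closed_UN closed_Un closed_region)
  have sub: "I \<subseteq> disc" "R \<subseteq> disc" using region_subset by (auto simp: I_def R_def)
  have "disc = I \<union> R"
  proof
    show "disc \<subseteq> I \<union> R"
    proof
      fix p assume "p \<in> disc"
      then obtain g where g: "g \<le> N" "p \<in> region d g" using cover by blast
      then have "g \<in> {Suc x..y - 1} \<or> g \<in> {y..N} \<or> g \<in> {0..x}" by auto
      then show "p \<in> I \<union> R" using g by (auto simp: I_def R_def)
    qed
  qed (use sub in auto)
  then have conn: "topological_space_class.connected (I \<inter> R)"
    using \<open>topological_space_class.connected I\<close> \<open>topological_space_class.connected R\<close> \<open>closed I\<close> \<open>closed R\<close> sub
    by (intro unicoherentD[OF convex_imp_unicoherent[OF convex_disc]] closed_subset) auto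
  let ?P = "{z \<in> {Suc x..y - 1}. card (separating x z) \<le> 4 * d + 4}"
  let ?Q = "{z \<in> {Suc x..y - 1}. card (separating z y) \<le> 4 * d + 4}"
  let ?A = "\<Union>z\<in>?P. region d z" and ?B = "\<Union>z\<in>?Q. region d z"
  \<comment> \<open>The triangle inequality through \<open>w\<close> gives
    \<open>(2 * d + 2) + (2 * d + 2)\<close>.\<close>
  have near: "z \<in> ?P" if "z \<in> {Suc x..y - 1}" "p \<in> region d z" "p \<in> region d w" "card (separating w x) \<le> 2 * d + 2" for z w p
    using that separating_triangle[of x z w] regions_meet[of p d w z] separating_sym[of w x] by simp
  \<comment> \<open>If the scanline \<open>w x\<close> has at least \<open>2 * d + 3\<close> chords,
    uncrossing bounds the scanline \<open>z y\<close> by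
    \<open>(4 * d + 4) + (2 * d + 2) - (2 * d + 3)\<close>.\<close>
  have far: "z \<in> ?Q" if "z \<in> {Suc x..y - 1}" "p \<in> region d z" "p \<in> region d w"
      "\<not> card (separating w x) \<le> 2 * d + 2" "w \<le> x \<or> y \<le> w" for z w p
  proof -
    have "x < z" "z < y" using that(1) xy by auto
    then show ?thesis
      using separating_uncross[OF _ _ that(5), of z] regions_meet[OF that(3,2)] that(1,4) xy(3) by simp
  qed
  have R: "\<exists>w. p \<in> region d w \<and> (w \<le> x \<or> y \<le> w)" if "p \<in> R" for p
    using that by (auto simp: R_def)
  have "closed ?A" "closed ?B" by (auto intro!: closed_UN closed_region)
  moreover have "I \<inter> R \<subseteq> ?A \<union> ?B"
  proof
    fix p assume p: "p \<in> I \<inter> R"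
    then obtain z w where "z \<in> {Suc x..y - 1}" "p \<in> region d z" "p \<in> region d w" "w \<le> x \<or> y \<le> w"
      using R[of p] unfolding I_def by blast
    then show "p \<in> ?A \<union> ?B" using near[of z p w] far[of z p w] by blast
  qed
  moreover have "?A \<inter> (I \<inter> R) \<noteq> {}"
  proof -
    have "gap_point x \<in> region d (Suc x)" "gap_point x \<in> region d x" "Suc x \<in> ?P"
      using card_separating_Suc[of x] d xy by (auto simp: gap_point_in_region separating_self)
    then have "gap_point x \<in> ?A \<inter> (I \<inter> R)" using xy unfolding I_def R_def by fastforce
    then show ?thesis by blast
  qed
  moreover have "?B \<inter> (I \<inter> R) \<noteq> {}"
  proof -
    have "card (separating (y - 1) y) \<le> 1" using card_separating_Suc[of "y - 1"] xy by simp
    then have "gap_point y \<in> region d (y - 1)" "gap_point y \<in> region d y" "y - 1 \<in> ?Q"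
      using d xy separating_sym[of y "y - 1"] by (auto simp: gap_point_in_region separating_self)
    then have "gap_point y \<in> ?B \<inter> (I \<inter> R)" using xy unfolding I_def R_def by fastforce
    then show ?thesis by blast
  qed
  ultimately have "?A \<inter> ?B \<inter> (I \<inter> R) \<noteq> {}"
    using connected_closedD[OF conn, of ?A ?B] by metis
  then obtain p z z' where p: "p \<in> R" "z \<in> ?P" "p \<in> region d z" "z' \<in> ?Q" "p \<in> region d z'" by blast
  then obtain w where w: "p \<in> region d w" "w \<le> x \<or> y \<le> w" using R by blast
  \<comment> \<open>The same \<open>w\<close> serves both gaps: if the scanline \<open>w x\<close>
    is light, \<open>z'\<close> also belongs to \<open>?P\<close>, and otherwise \<open>z\<close>
    also belongs to \<open>?Q\<close>.\<close>
  have "z' \<in> ?P \<or> z \<in> ?Q" using near[of z' p w] far[of z p w] p w by blast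
  then obtain u where "u \<in> ?P" "u \<in> ?Q" using p by blast
  then show ?thesis by (intro exI[of _ u]) auto
qed

text \<open>A point above the parabola but below the line of a chord has its abscissa strictly
  between the two ends.\<close>

lemma side_neg_imp_between:
  assumes "p \<in> disc" "v \<in> V" "side v p < 0"
  shows "\<tau> (l v) < fst p" "fst p < \<tau> (r v)"
proof -
  have "(fst p - \<tau> (l v)) * (fst p - \<tau> (r v)) \<le> side v p"
    using disc_above_parabola[OF assms(1)] by (simp add: side_def algebra_simps power2_eq_square)
  then have "(fst p - \<tau> (l v)) * (fst p - \<tau> (r v)) < 0" using assms(3) by simp
  moreover have "\<tau> (l v) < \<tau> (r v)"
    using assms(2) \<tau>_less_iff l_less_r l_less_N r_less_N by blast
  ultimately show "\<tau> (l v) < fst p" "fst p < \<tau> (r v)" by (auto simp: mult_less_0_iff)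
qed

text \<open>For two chords, a gap is needed that lies on the side of \<open>p\<close> for both. Gap
  \<open>0\<close> serves if \<open>p\<close> is above both; if \<open>p\<close> is below both,
  their intervals share the abscissa of \<open>p\<close> and so a gap just after the later left
  end.\<close>

lemma pointed_diagram_at:
  assumes p: "p \<in> disc"
  shows "pointed_diagram V l r N (\<lambda>v. 0 < side v p) {v \<in> V. side v p \<noteq> 0}"
proof -
  interpret oriented_diagram V l r N "\<lambda>v. 0 < side v p" by unfold_locales
  \<comment> \<open>Here \<open>p\<close> is above \<open>u\<close> and below \<open>v\<close>. Only
    an interval of \<open>v\<close> inside that of \<open>u\<close> could prevent such a gap, but
    then the line of \<open>u\<close> is not below that of \<open>v\<close> at the abscissa of
    \<open>p\<close>, and \<open>p\<close> would be below \<open>u\<close> too.\<close>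
  have mixed: "\<exists>g\<le>N. \<not> between u g \<and> between v g"
    if u: "u \<in> V" "0 < side u p" and v: "v \<in> V" "side v p < 0" for u v
  proof -
    have lr: "l v < r v" "r v < N" using v l_less_r r_less_N by auto
    consider "l v < l u" | "r u < r v" | "l u \<le> l v" "r v \<le> r u" by linarith
    then show ?thesis
    proof cases
      case 1
      then show ?thesis using lr by (intro exI[of _ "Suc (l v)"]) (auto simp: between_def)
    next
      case 2
      then show ?thesis using lr by (intro exI[of _ "r v"]) (auto simp: between_def)
    next
      case 3
      have le: "\<tau> (l u) \<le> \<tau> (l v)" "\<tau> (r v) \<le> \<tau> (r u)"
        using 3 u(1) v(1) \<tau>_less_iff l_less_N r_less_N by (meson not_le)+
      have in_v: "\<tau> (l v) < fst p" "fst p < \<tau> (r v)" using side_neg_imp_between[OF p v] by auto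
      have "(fst p - \<tau> (l v)) * (\<tau> (r v) - fst p) \<le> (fst p - \<tau> (l u)) * (\<tau> (r u) - fst p)"
        using le in_v by (intro mult_mono) auto
      then have "side u p \<le> side v p" by (simp add: side_def algebra_simps)
      then show ?thesis using u v by simp
    qed
  qed
  show ?thesis
  proof unfold_locales
    fix u v assume "u \<in> {v \<in> V. side v p \<noteq> 0}" "v \<in> {v \<in> V. side v p \<noteq> 0}"
    then have uv: "u \<in> V" "v \<in> V" "side u p \<noteq> 0" "side v p \<noteq> 0" by auto
    consider "0 < side u p" "0 < side v p" | "0 < side u p" "side v p < 0"
      | "side u p < 0" "0 < side v p" | "side u p < 0" "side v p < 0"
      using uv by linarith
    then show "\<exists>g\<le>N. \<not> arc u g \<and> \<not> arc v g"
    proof cases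
      case 1
      then show ?thesis by (intro exI[of _ 0]) (auto simp: arc_def not_between_0)
    next
      case 2
      then show ?thesis using mixed[of u v] uv by (auto simp: arc_def)
    next
      case 3
      then show ?thesis using mixed[of v u] uv by (auto simp: arc_def)
    next
      case 4
      have "\<tau> (l u) < \<tau> (r v)" "\<tau> (l v) < \<tau> (r u)"
        using side_neg_imp_between[OF p uv(1) 4(1)] side_neg_imp_between[OF p uv(2) 4(2)] by auto
      then have "l u < r v" "l v < r u" using uv \<tau>_less_iff l_less_N r_less_N by auto
      then have "between u (Suc (max (l u) (l v)))" "between v (Suc (max (l u) (l v)))" "Suc (max (l u) (l v)) \<le> N"
        using l_less_r[OF uv(1)] l_less_r[OF uv(2)] r_less_N[OF uv(1)] r_less_N[OF uv(2)]
        by (auto simp: between_def)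
      then show ?thesis using 4 by (intro exI[of _ "Suc (max (l u) (l v))"]) (auto simp: arc_def)
    qed
  qed auto
qed

text \<open>Geometric depth becomes the number of arcs over a gap, the form in which
  \<open>nested_covers\<close> takes it.\<close>

lemma separated_eq_arcs:
  "separated p g = {v \<in> {v \<in> V. side v p \<noteq> 0}. oriented_diagram.arc l r (\<lambda>v. 0 < side v p) v g}"
proof -
  interpret oriented_diagram V l r N "\<lambda>v. 0 < side v p" by unfold_locales
  have "side v p * side v (gap_point g) < 0 \<longleftrightarrow> side v p \<noteq> 0 \<and> (between v g \<longleftrightarrow> 0 < side v p)" if "v \<in> V" for v
    using side_gap_point_neg_iff[OF that, of g] side_gap_point_neq_0[OF that, of g]
    by (auto simp: mult_less_0_iff)
  then show ?thesis by (auto simp: separated_def arc_def)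
qed

end

section \<open>The dichotomy: nested covers or small treewidth\<close>

context chord_diagram
begin

lemma exists_nested_covers:
  assumes G: "pverts G = V" "\<And>u v. (u, v) \<in> parcs G \<Longrightarrow> u \<in> V \<and> v \<in> V \<and> crosses u v"
    and "0 < t" "12 * t < treewidth G"
  shows "\<exists>M inner. (\<forall>i\<in>{1..t}. minimal_cover V l r N inner (M i)) \<and>
    (\<forall>i j. 1 \<le> i \<and> i < j \<and> j \<le> t \<longrightarrow>
       M i \<inter> M j = {} \<and> (\<forall>v\<in>M i. card {w \<in> M j. crosses v w} \<ge> 2))"
proof -
  obtain \<tau> :: "nat \<Rightarrow> real" where "\<forall>i<N. real i < \<tau> i \<and> \<tau> i < real i + 1"
    "\<forall>i j k l p q. distinct [i, j, k, l, p, q] \<and> {i, j, k, l, p, q} \<subseteq> {..<N} \<longrightarrow>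
        chord_det (\<tau> i) (\<tau> j) (\<tau> k) (\<tau> l) (\<tau> p) (\<tau> q) \<noteq> 0"
    using exists_generic_positions[of N] by blast
  then interpret drawn_diagram V l r N \<tau> by unfold_locales blast+
  have "\<exists>p\<in>disc. \<forall>g\<le>N. 2 * t \<le> card (separated p g)"
  proof (rule ccontr)
    assume neg: "\<not> ?thesis"
    \<comment> \<open>With this value the scanline bound \<open>4 * d + 4\<close> is
      \<open>8 * t\<close>, and the treewidth would be at most \<open>12 * t\<close>.\<close>
    define d where "d = 2 * t - 1"
    have d: "1 \<le> d" "4 * d + 4 = 8 * t" using \<open>0 < t\<close> by (auto simp: d_def)
    have "\<exists>g\<le>N. p \<in> region d g" if "p \<in> disc" for p
    proof -
      obtain g where "g \<le> N" "card (separated p g) < 2 * t" using neg \<open>p \<in> disc\<close> by (meson not_le)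
      then show ?thesis using \<open>p \<in> disc\<close> by (auto simp: region_def d_def)
    qed
    then have "2 * treewidth G \<le> 3 * (4 * d + 4)"
      using exists_split[OF d(1)] G by (intro treewidth_le) auto
    then show False using d(2) \<open>12 * t < treewidth G\<close> by simp
  qed
  then obtain p where p: "p \<in> disc" "\<forall>g\<le>N. 2 * t \<le> card (separated p g)" by blast
  interpret pointed_diagram V l r N "\<lambda>v. 0 < side v p" "{v \<in> V. side v p \<noteq> 0}"
    using p(1) by (rule pointed_diagram_at)
  have "\<exists>M. (\<forall>i\<in>{1..t}. M i \<subseteq> {v \<in> V. side v p \<noteq> 0} \<and> covers (M i) \<and>
      minimal_cover V l r N (\<lambda>v. 0 < side v p) (M i)) \<and>
    (\<forall>i j. 1 \<le> i \<and> i < j \<and> j \<le> t \<longrightarrow>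
       M i \<inter> M j = {} \<and> (\<forall>v\<in>M i. card {w \<in> M j. crosses v w} \<ge> 2))"
    using p(2) unfolding separated_eq_arcs by (intro nested_covers) auto
  then show ?thesis by blast
qed

end

section \<open>Circle graphs as chord diagrams\<close>

text \<open>Chords may share endpoints, which a diagram forbids. Each end is therefore replaced by
  the rank of a lexicographic key, whose second component breaks ties without creating a
  crossing.\<close>

lemma exists_ranking:
  fixes l r :: "'a \<Rightarrow> real"
  assumes "finite V" "\<And>v. v \<in> V \<Longrightarrow> l v < r v"
    and inj: "\<And>u v. \<lbrakk>u \<in> V; v \<in> V; l u = l v; r u = r v\<rbrakk> \<Longrightarrow> u = v"
  shows "\<exists>l' r' N. chord_diagram V l' r' N \<and> (\<forall>u\<in>V. \<forall>v\<in>V. chord_diagram.crosses l' r' u v \<longleftrightarrow>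
    l u < l v \<and> l v < r u \<and> r u < r v \<or> l v < l u \<and> l u < r v \<and> r v < r u)"
proof -
  have "finite (l ` V \<union> r ` V)" using assms(1) by simp
  then obtain b where "\<forall>x\<in>l ` V \<union> r ` V. \<bar>x\<bar> \<le> b"
    using finite_imp_bounded bounded_real by blast
  then have b: "\<bar>l v\<bar> < b + 1" "\<bar>r v\<bar> < b + 1" if "v \<in> V" for v using that by force+
  \<comment> \<open>Where several endpoints coincide, the right endpoints come first, and chords sharing an
    endpoint become nested or disjoint.\<close>
  define kl where "kl v = (l v, b + 1 - r v)" for v
  define kr where "kr v = (r v, - (b + 1) - l v)" for v
  define lt where "lt = (\<lambda>(p :: real \<times> real) q. fst p < fst q \<or> fst p = fst q \<and> snd p < snd q)"
  define K where "K = kl ` V \<union> kr ` V"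
  define rank where "rank k = card {k' \<in> K. lt k' k}" for k
  have fin: "finite K" using assms(1) by (simp add: K_def)
  have less: "rank p < rank q" if "p \<in> K" "lt p q" for p q
    unfolding rank_def
  proof (rule psubset_card_mono)
    have "{k' \<in> K. lt k' p} \<subseteq> {k' \<in> K. lt k' q}" using \<open>lt p q\<close> by (auto simp: lt_def)
    moreover have "p \<in> {k' \<in> K. lt k' q}" "p \<notin> {k' \<in> K. lt k' p}" using that by (auto simp: lt_def)
    ultimately show "{k' \<in> K. lt k' p} \<subset> {k' \<in> K. lt k' q}" by blast
  qed (use fin in simp)
  have total: "lt p q \<or> p = q \<or> lt q p" for p q
    by (cases p; cases q) (auto simp: lt_def)
  have rank_less: "rank p < rank q \<longleftrightarrow> lt p q" if "p \<in> K" "q \<in> K" for p q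
    using less[of p q] less[of q p] total[of p q] that by force
  have rank_eq: "rank p = rank q \<longleftrightarrow> p = q" if "p \<in> K" "q \<in> K" for p q
    using less[of p q] less[of q p] total[of p q] that by force
  have bound: "rank p < card K" if "p \<in> K" for p
    unfolding rank_def using fin that by (intro psubset_card_mono) (auto simp: lt_def)
  have K: "kl v \<in> K" "kr v \<in> K" if "v \<in> V" for v using that by (auto simp: K_def)
  have diag: "chord_diagram V (\<lambda>v. rank (kl v)) (\<lambda>v. rank (kr v)) (card K)"
  proof
    show "finite V" by fact
    show "rank (kl v) < rank (kr v)" if "v \<in> V" for v
      using that K assms(2) by (simp add: rank_less) (simp add: lt_def kl_def kr_def)
    show "rank (kr v) < card K" if "v \<in> V" for v using that K bound by blast
    show "inj_on (\<lambda>v. rank (kl v)) V"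
      using K inj by (intro inj_onI) (auto simp: rank_eq kl_def)
    show "inj_on (\<lambda>v. rank (kr v)) V"
      using K inj by (intro inj_onI) (auto simp: rank_eq kr_def)
    show "rank (kl u) \<noteq> rank (kr v)" if "u \<in> V" "v \<in> V" for u v
      using that K b[of u] b[of v] by (auto simp: rank_eq kl_def kr_def)
  qed
  have step: "l u < l v \<and> l v < r u \<and> r u < r v \<longleftrightarrow>
      rank (kl u) < rank (kl v) \<and> rank (kl v) < rank (kr u) \<and> rank (kr u) < rank (kr v)"
    if "u \<in> V" "v \<in> V" for u v
    using that K b[of u] b[of v] assms(2)[of u] assms(2)[of v]
    by (simp add: rank_less) (auto simp: lt_def kl_def kr_def)
  show ?thesis
    by (intro exI[of _ "\<lambda>v. rank (kl v)"] exI[of _ "\<lambda>v. rank (kr v)"] exI[of _ "card K"])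
      (simp add: diag chord_diagram.crosses_def[OF diag] step)
qed

text \<open>Stereographic projection from the point \<open>c + R u\<close> of the circle. In the orthonormal
  coordinates \<open>X\<close>, \<open>Y\<close> adapted to \<open>u\<close>, the point with parameter \<open>t\<close> is
  \<open>((t\<^sup>2 - 1) / (t\<^sup>2 + 1), 2 t / (t\<^sup>2 + 1))\<close>, and \<open>line a b\<close> is an equation of the line through the
  points with parameters \<open>a\<close> and \<open>b\<close>.\<close>

locale circle =
  fixes c u :: "real ^ 2" and R :: real
  assumes R_pos: "R > 0" and u_unit: "(u $ 1)\<^sup>2 + (u $ 2)\<^sup>2 = 1"
begin

definition X :: "real ^ 2 \<Rightarrow> real" where
  "X x = ((x $ 1 - c $ 1) * u $ 1 + (x $ 2 - c $ 2) * u $ 2) / R"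

definition Y :: "real ^ 2 \<Rightarrow> real" where
  "Y x = ((x $ 2 - c $ 2) * u $ 1 - (x $ 1 - c $ 1) * u $ 2) / R"

definition param :: "real ^ 2 \<Rightarrow> real" where
  "param x = Y x / (1 - X x)"

definition line :: "real \<Rightarrow> real \<Rightarrow> real ^ 2 \<Rightarrow> real" where
  "line a b x = (a * b - 1) * X x + (a + b) * Y x - (1 + a * b)"

definition punctured :: "(real ^ 2) set" where
  "punctured = sphere c R - {c + R *\<^sub>R u}"

lemma coordinates: "x $ 1 = c $ 1 + R * (X x * u $ 1 - Y x * u $ 2)" "x $ 2 = c $ 2 + R * (X x * u $ 2 + Y x * u $ 1)"
proof -
  have "R * (X x * u $ 1 - Y x * u $ 2) = (x $ 1 - c $ 1) * ((u $ 1)\<^sup>2 + (u $ 2)\<^sup>2)"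
    "R * (X x * u $ 2 + Y x * u $ 1) = (x $ 2 - c $ 2) * ((u $ 1)\<^sup>2 + (u $ 2)\<^sup>2)"
    using R_pos by (simp_all add: X_def Y_def field_simps power2_eq_square)
  then show "x $ 1 = c $ 1 + R * (X x * u $ 1 - Y x * u $ 2)" "x $ 2 = c $ 2 + R * (X x * u $ 2 + Y x * u $ 1)"
    by (simp_all add: u_unit)
qed

lemma eq_iff_coordinates: "x = y \<longleftrightarrow> X x = X y \<and> Y x = Y y"
proof
  assume "X x = X y \<and> Y x = Y y"
  then have "x $ 1 = y $ 1" "x $ 2 = y $ 2" using coordinates[of x] coordinates[of y] by simp_all
  then show "x = y" by (simp add: vec_eq_iff forall_2)
qed simp

lemma affine_X: "X ((1 - \<mu>) *\<^sub>R x + \<mu> *\<^sub>R y) = (1 - \<mu>) * X x + \<mu> * X y"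
  using R_pos by (simp add: X_def field_simps)

lemma affine_Y: "Y ((1 - \<mu>) *\<^sub>R x + \<mu> *\<^sub>R y) = (1 - \<mu>) * Y x + \<mu> * Y y"
  using R_pos by (simp add: Y_def field_simps)

lemma affine_line: "line a b ((1 - \<mu>) *\<^sub>R x + \<mu> *\<^sub>R y) = (1 - \<mu>) * line a b x + \<mu> * line a b y"
  unfolding line_def affine_X affine_Y by (simp add: algebra_simps)

lemma punctured_coordinates:
  assumes "x \<in> punctured" shows "(X x)\<^sup>2 + (Y x)\<^sup>2 = 1" "X x < 1"
proof -
  have "(dist c x)\<^sup>2 = R\<^sup>2" using assms by (simp add: punctured_def)
  then have "(c $ 1 - x $ 1)\<^sup>2 + (c $ 2 - x $ 2)\<^sup>2 = R\<^sup>2"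
    by (simp add: dist_vec_def L2_set_def sum_2 dist_real_def)
  moreover have "(c $ 1 - x $ 1)\<^sup>2 + (c $ 2 - x $ 2)\<^sup>2
      = R\<^sup>2 * (((X x)\<^sup>2 + (Y x)\<^sup>2) * ((u $ 1)\<^sup>2 + (u $ 2)\<^sup>2))"
    unfolding coordinates[of x] by (simp add: power2_eq_square algebra_simps)
  ultimately show 1: "(X x)\<^sup>2 + (Y x)\<^sup>2 = 1" using R_pos u_unit by simp
  have "X x \<noteq> 1"
  proof
    assume "X x = 1"
    then have "Y x = 0" using 1 by simp
    then have "x = c + R *\<^sub>R u"
      using coordinates[of x] \<open>X x = 1\<close> by (simp add: vec_eq_iff forall_2)
    then show False using assms by (simp add: punctured_def)
  qed
  moreover have "(X x)\<^sup>2 \<le> 1" using 1 zero_le_power2[of "Y x"] by linarith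
  then have "X x \<le> 1" by (auto simp: abs_square_le_1)
  ultimately show "X x < 1" by simp
qed

text \<open>The equation of the circle turns into
  \<open>(param x)\<^sup>2 * (1 - X x) = 1 + X x\<close>. As \<open>X x < 1\<close>, the sign of
  \<open>line a b\<close> at a point of the circle depends only on how its parameter lies relative
  to \<open>a\<close> and \<open>b\<close>.\<close>

lemma line_eq:
  assumes "x \<in> punctured"
  shows "line a b x = - ((1 - X x) * ((param x - a) * (param x - b)))"
proof -
  have x: "(X x)\<^sup>2 + (Y x)\<^sup>2 = 1" "X x < 1" using punctured_coordinates[OF assms] by auto
  have Y: "Y x = param x * (1 - X x)" using x(2) by (simp add: param_def)
  have "(param x)\<^sup>2 * (1 - X x)\<^sup>2 = (1 - X x) * (1 + X x)"
    using x(1) Y by (simp add: power_mult_distrib algebra_simps power2_eq_square)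
  then have "(1 - X x) * ((param x)\<^sup>2 * (1 - X x)) = (1 - X x) * (1 + X x)"
    by (simp add: power2_eq_square algebra_simps)
  then have "(param x)\<^sup>2 * (1 - X x) = 1 + X x" using x(2) by simp
  moreover have "line a b x + (1 - X x) * ((param x - a) * (param x - b)) = (param x)\<^sup>2 * (1 - X x) - (1 + X x)"
    unfolding line_def Y by (simp add: algebra_simps power2_eq_square)
  ultimately show ?thesis by (simp only: eq_neg_iff_add_eq_0)
qed

lemma param_inj:
  assumes "x \<in> punctured" "y \<in> punctured" "param x = param y" shows "x = y"
proof -
  have *: "(1 - X z) * (1 + (param z)\<^sup>2) = 2" if "z \<in> punctured" for z
  proof -
    have z: "(X z)\<^sup>2 + (Y z)\<^sup>2 = 1" "X z < 1" using punctured_coordinates[OF that] by auto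
    have Y: "Y z = param z * (1 - X z)" using z(2) by (simp add: param_def)
    have "(1 - X z) * ((1 - X z) * (1 + (param z)\<^sup>2)) = (1 - X z) * 2"
      using z(1) unfolding Y by (simp add: power2_eq_square algebra_simps)
    then show ?thesis using z(2) mult_left_cancel[of "1 - X z"] by fastforce
  qed
  have "1 + (param x)\<^sup>2 > 0" by (simp add: add_pos_nonneg)
  then have "1 - X x = 1 - X y"
    using *[OF assms(1)] *[OF assms(2)] assms(3) mult_right_cancel[of "1 + (param x)\<^sup>2"] by fastforce
  then have "X x = X y" by simp
  moreover have "Y x = param x * (1 - X x)" "Y y = param y * (1 - X y)"
    using punctured_coordinates(2)[OF assms(1)] punctured_coordinates(2)[OF assms(2)] by (simp_all add: param_def)
  ultimately show ?thesis using assms(3) by (simp add: eq_iff_coordinates)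
qed

lemma line_param:
  assumes "x \<in> punctured" shows "line (param x) b x = 0" "line b (param x) x = 0"
  using line_eq[OF assms] by auto

text \<open>The ends of each segment lie on opposite sides of the other line, so each open segment
  contains a point of the other line. Both points lie on both lines, which are not parallel, so they
  coincide.\<close>

lemma crossing_point:
  assumes "line a b p = 0" "line a b q = 0" "line a' b' p' = 0" "line a' b' q' = 0"
    and neg: "line a b p' * line a b q' < 0" "line a' b' p * line a' b' q < 0"
  shows "\<exists>z. z \<in> open_segment p q \<and> z \<in> open_segment p' q'"
proof -
  have zero: "\<exists>\<mu>. 0 < \<mu> \<and> \<mu> < 1 \<and> (1 - \<mu>) * s + \<mu> * t = 0" if "s * t < 0" for s t :: real
  proof (intro exI conjI)
    have "s \<noteq> t" using that by (auto simp: not_less)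
    then show "(1 - s / (s - t)) * s + s / (s - t) * t = 0" by (simp add: field_simps)
    show "0 < s / (s - t)" "s / (s - t) < 1"
      using that by (auto simp: mult_less_0_iff field_simps zero_less_divide_iff)
  qed
  obtain \<mu> where \<mu>: "0 < \<mu>" "\<mu> < 1" "(1 - \<mu>) * line a' b' p + \<mu> * line a' b' q = 0" using zero[OF neg(2)] by blast
  obtain \<nu> where \<nu>: "0 < \<nu>" "\<nu> < 1" "(1 - \<nu>) * line a b p' + \<nu> * line a b q' = 0" using zero[OF neg(1)] by blast
  define z where "z = (1 - \<mu>) *\<^sub>R p + \<mu> *\<^sub>R q"
  define z' where "z' = (1 - \<nu>) *\<^sub>R p' + \<nu> *\<^sub>R q'"
  have z: "line a b z = 0" "line a' b' z = 0" "line a b z' = 0" "line a' b' z' = 0"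
    using assms(1-4) \<mu>(3) \<nu>(3) by (simp_all add: z_def z'_def affine_line)
  \<comment> \<open>\<open>v\<close> is the difference of the two points and \<open>w\<close> the
    direction of \<open>p q\<close>. The linear part of the first line kills both, so they are
    parallel; that of the second kills \<open>v\<close> but not \<open>w\<close>, so
    \<open>v\<close> is zero.\<close>
  define v1 v2 w1 w2 where "v1 = X z - X z'" "v2 = Y z - Y z'" "w1 = X p - X q" "w2 = Y p - Y q"
  note d = this
  have n: "(a * b - 1) * v1 + (a + b) * v2 = 0" "(a' * b' - 1) * v1 + (a' + b') * v2 = 0"
      "(a * b - 1) * w1 + (a + b) * w2 = 0"
    using z assms(1,2) unfolding line_def d by (simp_all add: algebra_simps)
  have w: "(a' * b' - 1) * w1 + (a' + b') * w2 \<noteq> 0"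
  proof
    assume "(a' * b' - 1) * w1 + (a' + b') * w2 = 0"
    then have "line a' b' p = line a' b' q" unfolding line_def d by (simp add: algebra_simps)
    then show False using neg(2) by (simp add: not_less)
  qed
  have "a * b - 1 \<noteq> 0 \<or> a + b \<noteq> 0"
  proof (rule ccontr)
    assume "\<not> ?thesis"
    then have "line a b p' = line a b q'" unfolding line_def by simp
    then show False using neg(1) by (simp add: not_less)
  qed
  then have par: "v1 * w2 = v2 * w1"
  proof
    assume "a * b - 1 \<noteq> 0"
    moreover have "(a * b - 1) * (v1 * w2 - v2 * w1) = 0" using n(1,3) by algebra
    ultimately show ?thesis by simp
  next
    assume "a + b \<noteq> 0"
    moreover have "(a + b) * (v1 * w2 - v2 * w1) = 0" using n(1,3) by algebra
    ultimately show ?thesis by simp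
  qed
  have "((a' * b' - 1) * w1 + (a' + b') * w2) * v1 = 0" "((a' * b' - 1) * w1 + (a' + b') * w2) * v2 = 0"
    using n(2) par by algebra+
  then have "v1 = 0" "v2 = 0" using w by simp_all
  then have "z = z'" by (simp add: eq_iff_coordinates d)
  moreover have "p \<noteq> q" "p' \<noteq> q'" using neg by (auto simp: not_less)
  then have "z \<in> open_segment p q" "z' \<in> open_segment p' q'"
    using \<mu> \<nu> by (auto simp: z_def z'_def in_segment)
  ultimately show ?thesis by blast
qed

text \<open>By \<open>line_eq\<close>, the parameters interleave exactly if the line of each chord
  has the ends of the other on opposite sides.\<close>

lemma cross_iff_interleaved:
  assumes P: "p \<in> punctured" "q \<in> punctured" "p' \<in> punctured" "q' \<in> punctured"
    and ord: "param p < param q" "param p' < param q'"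
  shows "(\<exists>z. cross_at z (closed_segment p q) (closed_segment p' q')) \<longleftrightarrow>
    param p < param p' \<and> param p' < param q \<and> param q < param q' \<or>
    param p' < param p \<and> param p < param q' \<and> param q' < param q" (is "?L \<longleftrightarrow> ?R")
proof
  let ?f = "line (param p) (param q)"
  have f0: "?f p = 0" "?f q = 0" using line_param P by auto
  assume ?L
  then obtain z where z: "closed_segment p q \<noteq> closed_segment p' q'" "z \<in> closed_segment p q"
      "z \<in> closed_segment p' q'" "\<not> endpoint_of z (closed_segment p' q')"
    by (auto simp: cross_at_def)
  have "z \<noteq> p'" "z \<noteq> q'"
    using z(4) by (auto simp: endpoint_of_def closed_segment_commute)
  then have "z \<in> open_segment p' q'" using z(3) by (simp add: open_segment_def)
  then obtain \<mu> where \<mu>: "0 < \<mu>" "\<mu> < 1" "z = (1 - \<mu>) *\<^sub>R p' + \<mu> *\<^sub>R q'" by (auto simp: in_segment)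
  obtain \<nu> where "z = (1 - \<nu>) *\<^sub>R p + \<nu> *\<^sub>R q" using z(2) by (auto simp: in_segment)
  then have "?f z = 0" using f0 by (simp add: affine_line)
  then have comb: "(1 - \<mu>) * ?f p' + \<mu> * ?f q' = 0" unfolding \<mu>(3) affine_line .
  define P' Q' where "P' = (param p' - param p) * (param p' - param q)" "Q' = (param q' - param p) * (param q' - param q)"
  note PQ = this
  have f: "?f p' = - ((1 - X p') * P')" "?f q' = - ((1 - X q') * Q')"
    unfolding PQ using line_eq P by blast+
  define s t where "s = (1 - \<mu>) * (1 - X p')" "t = \<mu> * (1 - X q')"
  have st: "s > 0" "t > 0" using \<mu> punctured_coordinates(2) P unfolding s_t_def by simp_all
  have "s * P' + t * Q' = 0" using comb unfolding f s_t_def by (simp add: algebra_simps)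
  then have sum: "t * Q' = - (s * P')" by simp
  \<comment> \<open>The weights \<open>s\<close> and \<open>t\<close> are positive, so the values at
    \<open>p'\<close> and \<open>q'\<close> have opposite signs or both vanish. In the last case the
    two chords would be equal.\<close>
  consider "P' < 0" "Q' > 0" | "P' > 0" "Q' < 0" | "P' = 0" "Q' = 0"
  proof (cases P' "0 :: real" rule: linorder_cases)
    case less
    then have "s * P' < 0" using st by (simp add: mult_pos_neg)
    then have "t * Q' > 0" using sum by simp
    then have "Q' > 0" using st by (simp add: zero_less_mult_iff)
    then show ?thesis using less that by blast
  next
    case greater
    then have "s * P' > 0" using st by simp
    then have "t * Q' < 0" using sum by simp
    then have "Q' < 0" using st by (simp add: mult_less_0_iff)
    then show ?thesis using greater that by blast
  next
    case equal
    then show ?thesis using sum st that by simp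
  qed
  then show ?R
  proof cases
    case 1
    then show ?thesis using ord unfolding PQ by (auto simp: mult_less_0_iff zero_less_mult_iff)
  next
    case 2
    then show ?thesis using ord unfolding PQ by (auto simp: mult_less_0_iff zero_less_mult_iff)
  next
    case 3
    then have "param p' = param p" "param q' = param q" using ord unfolding PQ by auto
    then show ?thesis using z(1) param_inj P by blast
  qed
next
  assume R: ?R
  let ?f = "line (param p) (param q)" and ?g = "line (param p') (param q')"
  have prod: "line a b x * line a b y = ((1 - X x) * (1 - X y)) * (((param x - a) * (param x - b)) * ((param y - a) * (param y - b)))"
    if "x \<in> punctured" "y \<in> punctured" for a b x y
    unfolding line_eq[OF that(1)] line_eq[OF that(2)] by simp
  have pos: "(1 - X x) * (1 - X y) > 0" if "x \<in> punctured" "y \<in> punctured" for x y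
    using punctured_coordinates(2) that by simp
  have neg: "((x - a) * (x - b)) * ((y - a) * (y - b)) < 0"
    if "a < x \<and> x < b \<and> b < y \<or> x < a \<and> a < y \<and> y < b" for a b x y :: real
    using that
  proof
    assume "a < x \<and> x < b \<and> b < y"
    then show ?thesis by (intro mult_neg_pos mult_pos_neg mult_pos_pos) auto
  next
    assume "x < a \<and> a < y \<and> y < b"
    then show ?thesis by (intro mult_pos_neg mult_neg_neg) auto
  qed
  have "?f p' * ?f q' < 0" "?g p * ?g q < 0"
    unfolding prod[OF P(3,4)] prod[OF P(1,2)]
    using R mult_pos_neg[OF pos[OF P(3,4)] neg] mult_pos_neg[OF pos[OF P(1,2)] neg] by blast+
  then obtain z where z: "z \<in> open_segment p q" "z \<in> open_segment p' q'"
    using crossing_point[of "param p" "param q" p q "param p'" "param q'" p' q'] line_param P by blast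
  have "\<not> endpoint_of z (closed_segment p q)" "\<not> endpoint_of z (closed_segment p' q')"
    using z by (auto simp: endpoint_of_def closed_segment_eq doubleton_eq_iff open_segment_def)
  moreover have "closed_segment p q \<noteq> closed_segment p' q'"
    using R ord by (auto simp: closed_segment_eq doubleton_eq_iff)
  ultimately have "cross_at z (closed_segment p q) (closed_segment p' q')"
    using z by (auto simp: cross_at_def open_segment_def)
  then show ?L ..
qed

end

text \<open>The centre of the projection must avoid all endpoints. It exists because the circle,
  being connected with more than one point, is infinite.\<close>

lemma chords_ranking:
  fixes c :: "real ^ 2"
  assumes "R > 0" "finite S" "\<forall>s\<in>S. chord_of (sphere c R) s"
  shows "\<exists>l r N. chord_diagram S l r N \<and>
    (\<forall>s\<in>S. \<forall>s'\<in>S. chord_diagram.crosses l r s s' \<longleftrightarrow> (\<exists>z. cross_at z s s'))"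
proof -
  obtain A B where AB: "\<forall>s\<in>S. A s \<in> sphere c R \<and> B s \<in> sphere c R \<and> A s \<noteq> B s \<and> s = closed_segment (A s) (B s)"
    using assms(3) unfolding chord_of_def by metis
  have "infinite (sphere c R)"
  proof
    assume "finite (sphere c R)"
    moreover have "topological_space_class.connected (sphere c R)" by (intro connected_sphere) simp
    moreover have "c + R *\<^sub>R axis 1 1 \<in> sphere c R" "c - R *\<^sub>R axis 1 1 \<in> sphere c R"
      using assms(1) by (auto simp: dist_norm norm_axis_1)
    ultimately have "c + R *\<^sub>R axis 1 1 = c - R *\<^sub>R axis 1 1"
      by (metis connected_finite_iff_sing empty_iff singletonD)
    then have "R * (axis 1 1 :: real ^ 2) $ 1 = - (R * (axis 1 1 :: real ^ 2) $ 1)"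
      unfolding vec_eq_iff by (metis add_left_cancel diff_conv_add_uminus vector_add_component vector_minus_component vector_scaleR_component real_scaleR_def)
    then show False using assms(1) by (simp add: axis_def)
  qed
  moreover have "finite (A ` S \<union> B ` S)" using assms(2) by simp
  ultimately obtain m where m: "m \<in> sphere c R" "m \<notin> A ` S \<union> B ` S"
    by (meson finite_subset subsetI)
  define u where "u = (1 / R) *\<^sub>R (m - c)"
  have mu: "c + R *\<^sub>R u = m" using assms(1) by (simp add: u_def)
  interpret circle c u R
  proof
    show "R > 0" by fact
    have "norm (m - c) = R" using m by (simp add: dist_norm norm_minus_commute)
    then have "norm u = 1" using assms(1) by (simp add: u_def)
    then show "(u $ 1)\<^sup>2 + (u $ 2)\<^sup>2 = 1"
      by (simp add: norm_vec_def L2_set_def sum_2)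
  qed
  have AB': "A s \<in> punctured" "B s \<in> punctured" if "s \<in> S" for s
    using AB m that unfolding punctured_def mu by auto
  define p where "p s = (if param (A s) < param (B s) then A s else B s)" for s
  define q where "q s = (if param (A s) < param (B s) then B s else A s)" for s
  have pq: "p s \<in> punctured" "q s \<in> punctured" "param (p s) < param (q s)" "s = closed_segment (p s) (q s)"
    if "s \<in> S" for s
  proof -
    have "param (A s) \<noteq> param (B s)" using AB AB' param_inj that by blast
    moreover have "s = closed_segment (A s) (B s)" "s = closed_segment (B s) (A s)"
      using AB that by (auto simp: closed_segment_commute)
    ultimately show "p s \<in> punctured" "q s \<in> punctured" "param (p s) < param (q s)" "s = closed_segment (p s) (q s)"
      using AB' that by (auto simp: p_def q_def)
  qed
  have inj: "s = s'" if "s \<in> S" "s' \<in> S" "param (p s) = param (p s')" "param (q s) = param (q s')" for s s'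
    using pq[OF that(1)] pq[OF that(2)] that(3,4) param_inj by metis
  have cross: "(\<exists>z. cross_at z s s') \<longleftrightarrow>
      param (p s) < param (p s') \<and> param (p s') < param (q s) \<and> param (q s) < param (q s') \<or>
      param (p s') < param (p s) \<and> param (p s) < param (q s') \<and> param (q s') < param (q s)"
    if "s \<in> S" "s' \<in> S" for s s'
    using cross_iff_interleaved[of "p s" "q s" "p s'" "q s'"] pq[OF that(1)] pq[OF that(2)] by metis
  obtain l r N where "chord_diagram S l r N" "\<forall>s\<in>S. \<forall>s'\<in>S. chord_diagram.crosses l r s s' \<longleftrightarrow>
      param (p s) < param (p s') \<and> param (p s') < param (q s) \<and> param (q s) < param (q s') \<or>
      param (p s') < param (p s) \<and> param (p s) < param (q s') \<and> param (q s') < param (q s)"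
    using exists_ranking[of S "\<lambda>s. param (p s)" "\<lambda>s. param (q s)"] assms(2) pq(3) inj by blast
  then show ?thesis using cross by blast
qed

text \<open>The diagram of the chords is pulled back along the isomorphism. Its arc map is
  determined by its vertex map \<open>\<phi>\<close>, because the arcs of both graphs are pairs of
  vertices.\<close>

lemma circle_graph_diagram:
  assumes "circle_graph G"
  shows "\<exists>l r N. chord_diagram (pverts G) l r N \<and>
    (\<forall>u v. (u, v) \<in> parcs G \<longleftrightarrow> u \<in> pverts G \<and> v \<in> pverts G \<and> chord_diagram.crosses l r u v)"
proof -
  obtain c :: "real ^ 2" and R S where S: "R > 0" "finite S" "\<forall>s\<in>S. chord_of (sphere c R) s"
    "digraph_iso (with_proj G) (with_proj (crossing_graph S))"
    using assms unfolding circle_graph_def by blast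
  obtain f where f: "pre_digraph.digraph_isomorphism (with_proj G) f"
    and X: "with_proj (crossing_graph S) = app_iso f (with_proj G)"
    using S(4) unfolding digraph_iso_def by blast
  define \<phi> where "\<phi> = iso_verts f"
  have wf: "wf_digraph (with_proj G)" and inj: "inj_on \<phi> (pverts G)"
    and ends: "\<forall>a\<in>parcs G. \<phi> (fst a) = iso_tail f (iso_arcs f a) \<and> \<phi> (snd a) = iso_head f (iso_arcs f a)"
    using f by (auto simp: pre_digraph.digraph_isomorphism_def \<phi>_def)
  have V: "\<phi> ` pverts G = S" and E: "iso_arcs f ` parcs G = parcs (crossing_graph S)"
    and "iso_tail f = fst" "iso_head f = snd"
    using arg_cong[OF X, of verts] arg_cong[OF X, of arcs] arg_cong[OF X, of tail] arg_cong[OF X, of head]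
    by (auto simp: \<phi>_def crossing_graph_def)
  then have arc: "iso_arcs f (a, b) = (\<phi> a, \<phi> b)" if "(a, b) \<in> parcs G" for a b
    using ends that by (metis fst_conv prod.collapse snd_conv)
  have wf': "a \<in> pverts G \<and> b \<in> pverts G" if "(a, b) \<in> parcs G" for a b
    using wf that by (fastforce simp: wf_digraph_def)
  obtain l r N where d: "chord_diagram S l r N"
    "\<forall>s\<in>S. \<forall>s'\<in>S. chord_diagram.crosses l r s s' \<longleftrightarrow> (\<exists>z. cross_at z s s')"
    using chords_ranking[OF S(1-3)] by blast
  have arcs: "(a, b) \<in> parcs G \<longleftrightarrow> (\<exists>z. cross_at z (\<phi> a) (\<phi> b))" if "a \<in> pverts G" "b \<in> pverts G" for a b
  proof
    assume "(a, b) \<in> parcs G"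
    then have "(\<phi> a, \<phi> b) \<in> parcs (crossing_graph S)" using arc E by (metis image_eqI)
    then show "\<exists>z. cross_at z (\<phi> a) (\<phi> b)" by (simp add: crossing_graph_def)
  next
    assume "\<exists>z. cross_at z (\<phi> a) (\<phi> b)"
    then have "(\<phi> a, \<phi> b) \<in> iso_arcs f ` parcs G" using V that by (auto simp: E crossing_graph_def)
    then obtain a' b' where "(a', b') \<in> parcs G" "\<phi> a = \<phi> a'" "\<phi> b = \<phi> b'" using arc by fastforce
    then show "(a, b) \<in> parcs G" using inj that wf' by (metis inj_onD)
  qed
  interpret S: chord_diagram S l r N by fact
  have S\<phi>: "\<phi> v \<in> S" if "v \<in> pverts G" for v using V that by blast
  have diag: "chord_diagram (pverts G) (l \<circ> \<phi>) (r \<circ> \<phi>) N"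
  proof
    show "finite (pverts G)" using V S(2) inj finite_imageD by blast
    show "inj_on (l \<circ> \<phi>) (pverts G)" using inj V S.inj_l by (simp add: comp_inj_on)
    show "inj_on (r \<circ> \<phi>) (pverts G)" using inj V S.inj_r by (simp add: comp_inj_on)
  qed (auto simp: S.l_less_r S.r_less_N S.l_neq_r S\<phi>)
  have "chord_diagram.crosses (l \<circ> \<phi>) (r \<circ> \<phi>) u v \<longleftrightarrow> S.crosses (\<phi> u) (\<phi> v)" for u v
    by (simp add: chord_diagram.crosses_def[OF diag] S.crosses_def)
  then have "(u, v) \<in> parcs G \<longleftrightarrow> u \<in> pverts G \<and> v \<in> pverts G \<and> chord_diagram.crosses (l \<circ> \<phi>) (r \<circ> \<phi>) u v" for u v
    using arcs[of u v] wf'[of u v] d(2) S\<phi> by auto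
  then show ?thesis using diag by blast
qed

section \<open>Assembling the induced cycles from the covers\<close>

lemma induced_subgraph_with_proj:
  assumes "pair_wf_digraph G" "W \<subseteq> pverts G"
  shows "induced_subgraph (with_proj \<lparr>pverts = W, parcs = parcs G \<inter> W \<times> W\<rparr>) (with_proj G)"
  using assms wf_digraph_wp_iff[of G]
  by (auto simp: induced_subgraph_def subgraph_def wf_digraph_def compatible_def)

theorem theorem1:
  fixes t :: nat and G :: "'a pair_pre_digraph"
  assumes "circle_graph G"
    and "treewidth G \<ge> 12 * t + 2"
  shows "\<exists>(H :: 'a pair_pre_digraph) (C :: nat \<Rightarrow> 'a pair_pre_digraph).
     induced_subgraph (with_proj H) (with_proj G) \<and>
     pverts H = (\<Union>i\<in>{1..t}. pverts (C i)) \<and>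
     (\<forall>i\<in>{1..t}. cycle_graph (C i) \<and> induced_subgraph (with_proj (C i)) (with_proj H)) \<and>
     (\<forall>i j. 1 \<le> i \<and> i < j \<and> j \<le> t \<longrightarrow>
        pverts (C i) \<inter> pverts (C j) = {} \<and>
        (\<forall>v\<in>pverts (C i). card (neighbours_in G v (pverts (C j))) \<ge> 2)) \<and>
     (\<forall>v\<in>pverts G. \<forall>i\<in>{1..t}. card (neighbours_in G v (pverts (C i))) \<le> 4)"
proof -
  obtain l r N where "chord_diagram (pverts G) l r N" and
    E: "\<And>u v. (u, v) \<in> parcs G \<longleftrightarrow> u \<in> pverts G \<and> v \<in> pverts G \<and> chord_diagram.crosses l r u v"
    using circle_graph_diagram[OF assms(1)] by blast
  then interpret chord_diagram "pverts G" l r N by simp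
  obtain M inner where M: "\<forall>i\<in>{1..t}. minimal_cover (pverts G) l r N inner (M i)"
    and nested: "\<forall>i j. 1 \<le> i \<and> i < j \<and> j \<le> t \<longrightarrow>
       M i \<inter> M j = {} \<and> (\<forall>v\<in>M i. card {w \<in> M j. crosses v w} \<ge> 2)"
  \<comment> \<open>For \<open>t = 0\<close> the index ranges are empty, and
    \<open>exists_nested_covers\<close> is stated for positive \<open>t\<close>.\<close>
  proof (cases "t = 0")
    case False
    then show ?thesis
      using exists_nested_covers[of G t] E assms(2) that by auto
  qed (use that in auto)
  have sub: "M i \<subseteq> pverts G" if "i \<in> {1..t}" for i
    using M that minimal_cover.M_subset by blast
  have wf: "pair_wf_digraph G" using E by unfold_locales auto
  have nb: "neighbours_in G v (M i) = {w \<in> M i. crosses v w}" if "v \<in> pverts G" "i \<in> {1..t}" for v i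
    using E that sub[of i] by (auto simp: neighbours_in_def)
  define W where "W = (\<Union>i\<in>{1..t}. M i)"
  define H where "H = \<lparr>pverts = W, parcs = parcs G \<inter> W \<times> W\<rparr>"
  define C where "C i = \<lparr>pverts = M i, parcs = parcs H \<inter> M i \<times> M i\<rparr>" for i
  have pC: "pverts (C i) = M i" for i by (simp add: C_def)
  have "W \<subseteq> pverts G" unfolding W_def using sub by blast
  then have ind: "induced_subgraph (with_proj H) (with_proj G)"
    unfolding H_def by (rule induced_subgraph_with_proj[OF wf])
  have wfH: "pair_wf_digraph H" by unfold_locales (auto simp: H_def)
  have cycles: "cycle_graph (C i) \<and> induced_subgraph (with_proj (C i)) (with_proj H)" if i: "i \<in> {1..t}" for i
  proof
    have MW: "M i \<subseteq> W" using i by (auto simp: W_def)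
    then show "induced_subgraph (with_proj (C i)) (with_proj H)"
      unfolding C_def by (intro induced_subgraph_with_proj[OF wfH]) (simp add: H_def)
    interpret minimal_cover "pverts G" l r N inner "M i" using M i by blast
    have arcs: "(u, v) \<in> parcs (C i) \<longleftrightarrow> u \<in> M i \<and> v \<in> M i \<and> crosses u v" for u v
      using MW sub[OF i] by (auto simp: C_def H_def E)
    let ?n = "length ordering"
    have "parcs (C i) = (\<Union>k<?n. {(ordering ! k, ordering ! (Suc k mod ?n)), (ordering ! (Suc k mod ?n), ordering ! k)})"
    proof (intro set_eqI iffI)
      fix e assume "e \<in> parcs (C i)"
      then show "e \<in> (\<Union>k<?n. {(ordering ! k, ordering ! (Suc k mod ?n)), (ordering ! (Suc k mod ?n), ordering ! k)})"
        using arcs cycle_ordering(2) by (cases e) auto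
    next
      fix e assume "e \<in> (\<Union>k<?n. {(ordering ! k, ordering ! (Suc k mod ?n)), (ordering ! (Suc k mod ?n), ordering ! k)})"
      then obtain k where k: "k < ?n" "e = (ordering ! k, ordering ! (Suc k mod ?n)) \<or> e = (ordering ! (Suc k mod ?n), ordering ! k)"
        by blast
      have "Suc k mod ?n < ?n" using k by (intro mod_less_divisor) auto
      then have "ordering ! k \<in> M i" "ordering ! (Suc k mod ?n) \<in> M i"
        using k ordering(1) nth_mem by blast+
      moreover from this have "crosses (ordering ! k) (ordering ! (Suc k mod ?n))"
        using cycle_ordering(2) k(1) by blast
      ultimately show "e \<in> parcs (C i)" using k(2) arcs crosses_sym by metis
    qed
    then show "cycle_graph (C i)"
      unfolding cycle_graph_def using ordering cycle_ordering(1) by (intro exI[of _ ordering]) (simp add: C_def)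
  qed
  have four: "card (neighbours_in G v (M i)) \<le> 4" if "v \<in> pverts G" "i \<in> {1..t}" for v i
    using minimal_cover.few_crossings[of "pverts G" l r N inner "M i" v] M that nb by simp
  have two: "M i \<inter> M j = {} \<and> (\<forall>v\<in>M i. card (neighbours_in G v (M j)) \<ge> 2)"
    if ij: "1 \<le> i" "i < j" "j \<le> t" for i j
  proof -
    have "i \<in> {1..t}" "j \<in> {1..t}" using ij by auto
    moreover have "M i \<inter> M j = {}" "\<forall>v\<in>M i. card {w \<in> M j. crosses v w} \<ge> 2" using nested ij by blast+
    ultimately show ?thesis using nb sub by (auto simp: subset_iff)
  qed
  show ?thesis
  proof (intro exI[of _ H] exI[of _ C] conjI)
    show "pverts H = (\<Union>i\<in>{1..t}. pverts (C i))" by (simp add: H_def W_def pC)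
    show "\<forall>i j. 1 \<le> i \<and> i < j \<and> j \<le> t \<longrightarrow>
        pverts (C i) \<inter> pverts (C j) = {} \<and>
        (\<forall>v\<in>pverts (C i). card (neighbours_in G v (pverts (C j))) \<ge> 2)"
      unfolding pC using two by blast
    show "\<forall>v\<in>pverts G. \<forall>i\<in>{1..t}. card (neighbours_in G v (pverts (C i))) \<le> 4"
      unfolding pC using four by blast
  qed (use ind cycles in blast)+
qed

end
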